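(* Let $E$ be a UCP space with the Jordan decomposition property and such that $I_3(e_1,e_2,e_3)=0$ for all mutually orthogonal events $e_1,e_2,e_3\in E$. Let $A$ be the order-unit space generated by $E$, with predual $V$. Then, for each $x\in A$, the map $e\mapsto T_ex$ from $E$ to $A$ has a unique $\sigma(A,V)$-continuous linear extension $y\mapsto T_yx$ on $A$.
   Context: Quantum logic: a set $E$ with distinguished elements $0,\mathbb{1}$, a relation $\perp$ (orthogonality) and a partial binary operation $+$ such that for $e,f,g\in E$: (OS1) $e\perp f$ implies $f\perp e$; (OS2) $e+f$ is defined for $e\perp f$, and then $e+f=f+e$; (OS3) if $g\perp e$, $g\perp f$, $e\perp f$, then $g\perp e+f$, $f\perp g+e$ and $g+(e+f)=(g+e)+f$; (OS4) $0\perp e$ and $e+0=e$ for all $e$; (OS5) for every $e$ there is a unique $e'\in E$ with $e\perp e'$ and $e+e'=\mathbb{1}$; (OS6) there exists $d\in E$ with $e\perp d$ and $e+d=f$ if and only if $e\perp f'$. A state is a map $\mu:E\to[0,1]$ with $\mu(\mathbb{1})=1$ and $\mu(e+f)=\mu(e)+\mu(f)$ whenever $e\perp f$; $S$ is the set of all states. If $\mu\in S$ and $\mu(e)>0$, a state $\nu$ is a conditional probability of $\mu$ under $e$ if $\nu(f)=\mu(f)/\mu(e)$ for all $f\in E$ with $f\perp e'$. UCP space: such an $E$ satisfying (UC1) if $\mu(e)=\mu(f)$ for all $\mu\in S$, then $e=f$; (UC2) if $\mu\in S$ and $\mu(e)>0$, there is exactly one conditional probability of $\mu$ under $e$, denoted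 $\mu_e$. Elements of $E$ are called events. Order-unit space generated by $E$: $V:=\{s\mu-t\nu:\mu,\nu\in S,\ 0\le s,t\in\mathbb{R}\}$, a linear space of real functions on $E$, with norm $\|\rho\|=\inf\{r\ge 0:\rho\in r\,\mathrm{conv}(S\cup -S)\}$. $A:=V^*$ is the dual Banach space. For $\rho\in V$ and $x\in A$ put $\hat\rho(x):=x(\rho)$. Order: $x\ge 0$ iff $\hat\mu(x)\ge0$ for all $\mu\in S$. Each $e\in E$ is identified with the element $\rho\mapsto\rho(e)$ of $A$ (an injective identification by (UC1)); $\mathbb{1}$ is the order unit, $e'=\mathbb{1}-e$, and $\|x\|=\sup\{|\hat\mu(x)|:\mu\in S\}$. $\sigma(A,V)$ is the weak-$*$ topology on $A$. For $e\in E$, $U_e:A\to A$ is the (well-defined) linear map with $(U_ex)(s\mu-t\nu)=s\mu(e)\hat\mu_e(x)-t\nu(e)\hat\nu_e(x)$ for $\mu,\nu\in S$, $s,t\ge0$, where $\mu(e)\hat\mu_e(x):=0$ if $\mu(e)=0$ (similarly for $\nu$). Further, $T_ex:=\frac12(x+U_ex-U_{e'}x)$ for $x\in A$. For mutually orthogonal $e_1,e_2,e_3\in E$, $$I_3(e_1,e_2,e_3):=U_{e_1+e_2+e_3}-U_{e_1+e_2}-U_{e_2+e_3}-U_{e_1+e_3}+U_{e_1}+U_{e_2}+U_{e_3}.$$ Jordan decomposition property of $E$: each bounded function $\rho:E\to\mathbb{R}$ that is orthogonally additive ($\rho(e+f)=\rho(e)+\rho(f)$ for $e\perp f$) can be written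 as $\rho=s\mu-t\nu$ with $\mu,\nu\in S$ and real $s,t\ge0$. *)

theory Defs
  imports "HOL-Analysis.Analysis"
begin

section \<open>Quantum logics\<close>

text \<open>The partial sum of a quantum logic is rendered by the total constant \<open>+\<close>; only its values
  \<open>e + f\<close> with \<open>orth e f\<close> are constrained or used.\<close>

class partial_sum = zero + one + plus +
  fixes orth :: "'a \<Rightarrow> 'a \<Rightarrow> bool"  (infix "\<bottom>" 50)
begin

definition compl :: "'a \<Rightarrow> 'a" where
  "compl e = (THE f. e \<bottom> f \<and> e + f = 1)"

definition states :: "('a \<Rightarrow> real) set" where
  "states = {\<mu>. (\<forall>e. \<mu> e \<in> {0..1}) \<and> \<mu> 1 = 1 \<and> (\<forall>e f. e \<bottom> f \<longrightarrow> \<mu> (e + f) = \<mu> e + \<mu> f)}"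

definition conditional_probability :: "('a \<Rightarrow> real) \<Rightarrow> 'a \<Rightarrow> ('a \<Rightarrow> real) \<Rightarrow> bool" where
  "conditional_probability \<mu> e \<nu> \<longleftrightarrow>
     \<nu> \<in> states \<and> (\<forall>f. f \<bottom> compl e \<longrightarrow> \<nu> f = \<mu> f / \<mu> e)"

definition cond :: "('a \<Rightarrow> real) \<Rightarrow> 'a \<Rightarrow> ('a \<Rightarrow> real)" where
  "cond \<mu> e = (THE \<nu>. conditional_probability \<mu> e \<nu>)"

end

class quantum_logic = partial_sum +
  assumes OS1: "e \<bottom> f \<Longrightarrow> f \<bottom> e"
    and OS2: "e \<bottom> f \<Longrightarrow> e + f = f + e"
    and OS3: "\<lbrakk>g \<bottom> e; g \<bottom> f; e \<bottom> f\<rbrakk> \<Longrightarrow> g \<bottom> e + f \<and> f \<bottom> g + e \<and> g + (e + f) = (g + e) + f"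
    and OS4: "0 \<bottom> e \<and> e + 0 = e"
    and OS5: "\<exists>!f. e \<bottom> f \<and> e + f = 1"
    and OS6: "(\<exists>d. e \<bottom> d \<and> e + d = f) \<longleftrightarrow> e \<bottom> compl f"

class ucp_space = quantum_logic +
  assumes UC1: "(\<And>\<mu>. \<mu> \<in> states \<Longrightarrow> \<mu> e = \<mu> f) \<Longrightarrow> e = f"
    and UC2: "\<lbrakk>\<mu> \<in> states; \<mu> e > 0\<rbrakk> \<Longrightarrow> \<exists>!\<nu>. conditional_probability \<mu> e \<nu>"

class jordan_ucp_space = ucp_space +
  assumes Jordan_decomposition:
    "\<lbrakk>bounded (range \<rho>); \<And>e f. e \<bottom> f \<Longrightarrow> \<rho> (e + f) = \<rho> e + \<rho> f\<rbrakk>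
      \<Longrightarrow> \<exists>s t \<mu> \<nu>. \<mu> \<in> states \<and> \<nu> \<in> states \<and> 0 \<le> s \<and> 0 \<le> t \<and> \<rho> = (\<lambda>e. s * \<mu> e - t * \<nu> e)"

section \<open>The base norm space \<open>V\<close> and its dual \<open>A\<close>\<close>

text \<open>The zero function is bounded and orthogonally additive, so the Jordan decomposition property
  provides a state. This is why \<open>V\<close> is set up over \<^class>\<open>jordan_ucp_space\<close>: for the
  one-element quantum logic, which satisfies (UC1) and (UC2) vacuously, \<open>V\<close> would be empty.\<close>

lemma states_nonempty: "(states :: ('e::jordan_ucp_space \<Rightarrow> real) set) \<noteq> {}"
  using Jordan_decomposition[of "\<lambda>_. 0"] by auto

lemma states_convex:
  assumes "\<mu> \<in> states" "\<nu> \<in> states" "0 \<le> a" "0 \<le> b" "a + b = (1::real)"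
  shows "(\<lambda>e. a * \<mu> e + b * \<nu> e) \<in> states"
proof -
  have "a * \<mu> e + b * \<nu> e \<le> 1" "0 \<le> a * \<mu> e + b * \<nu> e" for e
  proof -
    have "0 \<le> \<mu> e" "\<mu> e \<le> 1" "0 \<le> \<nu> e" "\<nu> e \<le> 1"
      using assms by (auto simp: states_def)
    moreover from this have "a * \<mu> e \<le> a * 1" "b * \<nu> e \<le> b * 1"
      using assms by (simp_all add: mult_left_le)
    ultimately show "a * \<mu> e + b * \<nu> e \<le> 1" "0 \<le> a * \<mu> e + b * \<nu> e"
      using assms by auto
  qed
  then show ?thesis
    using assms by (auto simp: states_def algebra_simps)
qed

text \<open>A nonnegative combination of two states is a multiple of a state.\<close>

lemma states_combine:
  assumes "\<mu> \<in> states" "\<nu> \<in> states" "0 \<le> a" "0 \<le> b"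
  obtains \<omega> where "\<omega> \<in> states" "\<And>e. a * \<mu> e + b * \<nu> e = (a + b) * \<omega> e"
proof (cases "a + b = 0")
  case True
  with assms have "a = 0" "b = 0" by auto
  with assms that show ?thesis by auto
next
  case False
  with assms have "a / (a + b) + b / (a + b) = 1" by (simp flip: add_divide_distrib)
  then have "(\<lambda>e. a / (a + b) * \<mu> e + b / (a + b) * \<nu> e) \<in> states"
    using assms by (intro states_convex) auto
  moreover have "a * \<mu> e + b * \<nu> e = (a + b) * (a / (a + b) * \<mu> e + b / (a + b) * \<nu> e)" for e
    using False by (simp add: distrib_left)
  ultimately show ?thesis using that by blast
qed

typedef (overloaded) 'e predual =
  "{\<rho> :: 'e::jordan_ucp_space \<Rightarrow> real.
      \<exists>s t \<mu> \<nu>. \<mu> \<in> states \<and> \<nu> \<in> states \<and> 0 \<le> s \<and> 0 \<le> t \<and> \<rho> = (\<lambda>e. s * \<mu> e - t * \<nu> e)}"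
  morphisms fun_of Abs_predual
  using states_nonempty by blast

setup_lifting type_definition_predual

lemma predual_eqI: "(\<And>e. fun_of \<rho> e = fun_of \<sigma> e) \<Longrightarrow> \<rho> = \<sigma>"
  by (metis ext fun_of_inject)

lemma fun_of_cases:
  obtains s t \<mu> \<nu> where "\<mu> \<in> states" "\<nu> \<in> states" "0 \<le> s" "0 \<le> t"
    "fun_of \<rho> = (\<lambda>e. s * \<mu> e - t * \<nu> e)"
  using fun_of[of \<rho>] by auto

instantiation predual :: (jordan_ucp_space) real_vector
begin

lift_definition zero_predual :: "'a predual" is "\<lambda>_. 0"
  using states_nonempty by (metis diff_self ex_in_conv mult_zero_left order_refl)

lift_definition plus_predual :: "'a predual \<Rightarrow> 'a predual \<Rightarrow> 'a predual" is "\<lambda>\<rho> \<sigma> e. \<rho> e + \<sigma> e"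
proof -
  fix \<rho> \<sigma> :: "'a \<Rightarrow> real"
  assume "\<exists>s t \<mu> \<nu>. \<mu> \<in> states \<and> \<nu> \<in> states \<and> 0 \<le> s \<and> 0 \<le> t \<and> \<rho> = (\<lambda>e. s * \<mu> e - t * \<nu> e)"
    and "\<exists>s t \<mu> \<nu>. \<mu> \<in> states \<and> \<nu> \<in> states \<and> 0 \<le> s \<and> 0 \<le> t \<and> \<sigma> = (\<lambda>e. s * \<mu> e - t * \<nu> e)"
  then obtain s t \<mu> \<nu> s' t' \<mu>' \<nu>' where
    *: "\<mu> \<in> states" "\<nu> \<in> states" "0 \<le> s" "0 \<le> t" "\<rho> = (\<lambda>e. s * \<mu> e - t * \<nu> e)"
       "\<mu>' \<in> states" "\<nu>' \<in> states" "0 \<le> s'" "0 \<le> t'" "\<sigma> = (\<lambda>e. s' * \<mu>' e - t' * \<nu>' e)"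
    by blast
  obtain \<omega> where 1: "\<omega> \<in> states" "\<And>e. s * \<mu> e + s' * \<mu>' e = (s + s') * \<omega> e"
    using states_combine[of \<mu> \<mu>' s s'] * by blast
  obtain \<omega>' where 2: "\<omega>' \<in> states" "\<And>e. t * \<nu> e + t' * \<nu>' e = (t + t') * \<omega>' e"
    using states_combine[of \<nu> \<nu>' t t'] * by blast
  have "\<rho> e + \<sigma> e = (s + s') * \<omega> e - (t + t') * \<omega>' e" for e
    using * 1(2)[of e] 2(2)[of e] by simp
  then show "\<exists>s t \<mu> \<nu>. \<mu> \<in> states \<and> \<nu> \<in> states \<and> 0 \<le> s \<and> 0 \<le> t \<and>
      (\<lambda>e. \<rho> e + \<sigma> e) = (\<lambda>e. s * \<mu> e - t * \<nu> e)"
    using * 1(1) 2(1) by (metis add_nonneg_nonneg)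
qed

lift_definition uminus_predual :: "'a predual \<Rightarrow> 'a predual" is "\<lambda>\<rho> e. - \<rho> e"
  by (metis minus_diff_eq)

definition minus_predual :: "'a predual \<Rightarrow> 'a predual \<Rightarrow> 'a predual" where
  "minus_predual \<rho> \<sigma> = \<rho> + - \<sigma>"

lift_definition scaleR_predual :: "real \<Rightarrow> 'a predual \<Rightarrow> 'a predual" is "\<lambda>a \<rho> e. a * \<rho> e"
proof -
  fix a :: real and \<rho> :: "'a \<Rightarrow> real"
  assume "\<exists>s t \<mu> \<nu>. \<mu> \<in> states \<and> \<nu> \<in> states \<and> 0 \<le> s \<and> 0 \<le> t \<and> \<rho> = (\<lambda>e. s * \<mu> e - t * \<nu> e)"
  then obtain s t \<mu> \<nu> where
    *: "\<mu> \<in> states" "\<nu> \<in> states" "0 \<le> s" "0 \<le> t" "\<rho> = (\<lambda>e. s * \<mu> e - t * \<nu> e)"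
    by blast
  show "\<exists>s t \<mu> \<nu>. \<mu> \<in> states \<and> \<nu> \<in> states \<and> 0 \<le> s \<and> 0 \<le> t \<and>
      (\<lambda>e. a * \<rho> e) = (\<lambda>e. s * \<mu> e - t * \<nu> e)"
  proof (cases "0 \<le> a")
    case True
    then show ?thesis using *
      by (intro exI[of _ "a * s"] exI[of _ "a * t"] exI[of _ \<mu>] exI[of _ \<nu>]) (auto simp: algebra_simps)
  next
    case False
    then show ?thesis using *
      by (intro exI[of _ "- a * t"] exI[of _ "- a * s"] exI[of _ \<nu>] exI[of _ \<mu>])
        (auto simp: algebra_simps mult_nonpos_nonneg)
  qed
qed

lemma fun_of_simps [simp]:
  "fun_of 0 e = 0" "fun_of (\<rho> + \<sigma>) e = fun_of \<rho> e + fun_of \<sigma> e" "fun_of (- \<rho>) e = - fun_of \<rho> e"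
  "fun_of (\<rho> - \<sigma>) e = fun_of \<rho> e - fun_of \<sigma> e" "fun_of (a *\<^sub>R \<rho>) e = a * fun_of \<rho> e"
  by (simp_all add: zero_predual.rep_eq plus_predual.rep_eq uminus_predual.rep_eq
      minus_predual_def scaleR_predual.rep_eq)

instance
  by standard (rule predual_eqI; simp add: algebra_simps)+

end

definition state_points :: "'e::jordan_ucp_space predual set" where
  "state_points = {\<rho>. fun_of \<rho> \<in> states}"

lemma fun_of_Abs_state [simp]: "\<mu> \<in> states \<Longrightarrow> fun_of (Abs_predual \<mu>) = \<mu>"
  by (rule Abs_predual_inverse, rule CollectI, rule exI[of _ 1], rule exI[of _ 0],
      intro exI[of _ \<mu>]) simp

lemma Abs_state_points [simp]: "\<mu> \<in> states \<Longrightarrow> Abs_predual \<mu> \<in> state_points"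
  by (simp add: state_points_def)

abbreviation unit_base :: "'e::jordan_ucp_space predual set" where
  "unit_base \<equiv> convex hull (state_points \<union> uminus ` state_points)"

lemma unit_base_minus: "\<rho> \<in> unit_base \<Longrightarrow> - \<rho> \<in> unit_base"
proof -
  assume "\<rho> \<in> unit_base"
  then have "- \<rho> \<in> uminus ` unit_base" by simp
  also have "uminus ` unit_base = convex hull (uminus ` (state_points \<union> uminus ` state_points))"
    by (rule convex_hull_linear_image) (simp add: linear_iff)
  also have "uminus ` (state_points \<union> uminus ` state_points) = state_points \<union> uminus ` (state_points :: 'a predual set)"
    by (auto simp: image_Un image_image)
  finally show ?thesis .
qed

lemma unit_base_bound:
  assumes "\<rho> \<in> unit_base"
  shows "\<bar>fun_of \<rho> e\<bar> \<le> 1"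
proof -
  have "unit_base \<subseteq> {\<rho>::'a predual. \<bar>fun_of \<rho> e\<bar> \<le> 1}"
  proof (rule hull_minimal)
    show "state_points \<union> uminus ` state_points \<subseteq> {\<rho>::'a predual. \<bar>fun_of \<rho> e\<bar> \<le> 1}"
      by (auto simp: state_points_def states_def)
    show "convex {\<rho>::'a predual. \<bar>fun_of \<rho> e\<bar> \<le> 1}"
    proof (rule convexI)
      fix x y :: "'a predual" and u v :: real
      assume *: "x \<in> {\<rho>. \<bar>fun_of \<rho> e\<bar> \<le> 1}" "y \<in> {\<rho>. \<bar>fun_of \<rho> e\<bar> \<le> 1}" "0 \<le> u" "0 \<le> v" "u + v = 1"
      have "\<bar>u * fun_of x e + v * fun_of y e\<bar> \<le> u * \<bar>fun_of x e\<bar> + v * \<bar>fun_of y e\<bar>"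
        using * by (intro order_trans[OF abs_triangle_ineq]) (simp add: abs_mult)
      also have "\<dots> \<le> u * 1 + v * 1" using * by (intro add_mono mult_left_mono) auto
      finally show "u *\<^sub>R x + v *\<^sub>R y \<in> {\<rho>. \<bar>fun_of \<rho> e\<bar> \<le> 1}" using * by simp
    qed
  qed
  then show ?thesis using assms by auto
qed

lemma unit_base_combine:
  assumes "\<rho> \<in> unit_base" "\<sigma> \<in> unit_base" "0 \<le> r" "0 \<le> q"
  shows "r *\<^sub>R \<rho> + q *\<^sub>R \<sigma> \<in> (*\<^sub>R) (r + q) ` unit_base"
proof (cases "r + q = 0")
  case True
  then have "r = 0" "q = 0" using assms by auto
  then show ?thesis using assms by (auto simp: image_iff)
next
  case False
  then have "(r / (r + q)) *\<^sub>R \<rho> + (q / (r + q)) *\<^sub>R \<sigma> \<in> unit_base"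
    using assms by (intro convexD[OF convex_convex_hull]) (auto simp flip: add_divide_distrib)
  moreover have "r *\<^sub>R \<rho> + q *\<^sub>R \<sigma> = (r + q) *\<^sub>R ((r / (r + q)) *\<^sub>R \<rho> + (q / (r + q)) *\<^sub>R \<sigma>)"
    using False by (simp add: scaleR_right_distrib)
  ultimately show ?thesis by blast
qed

lemma unit_base_absorbing: "\<exists>r\<ge>0. \<rho> \<in> (*\<^sub>R) r ` unit_base"
proof -
  obtain s t \<mu> \<nu> where *: "\<mu> \<in> states" "\<nu> \<in> states" "0 \<le> s" "0 \<le> t"
    "fun_of \<rho> = (\<lambda>e. s * \<mu> e - t * \<nu> e)"
    by (rule fun_of_cases)
  have eq: "\<rho> = s *\<^sub>R Abs_predual \<mu> + t *\<^sub>R (- Abs_predual \<nu>)"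
    using * by (intro predual_eqI) simp
  have "\<rho> \<in> (*\<^sub>R) (s + t) ` unit_base"
    unfolding eq using * by (intro unit_base_combine hull_inc) auto
  then show ?thesis using * by (intro exI[of _ "s + t"]) auto
qed

instantiation predual :: (jordan_ucp_space) real_normed_vector
begin

definition norm_predual :: "'a predual \<Rightarrow> real" where
  "norm_predual \<rho> = Inf {r. 0 \<le> r \<and> \<rho> \<in> (*\<^sub>R) r ` unit_base}"

definition dist_predual :: "'a predual \<Rightarrow> 'a predual \<Rightarrow> real" where
  "dist_predual \<rho> \<sigma> = norm (\<rho> - \<sigma>)"

definition sgn_predual :: "'a predual \<Rightarrow> 'a predual" where
  "sgn_predual \<rho> = \<rho> /\<^sub>R norm \<rho>"

definition uniformity_predual :: "('a predual \<times> 'a predual) filter" where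
  "uniformity_predual = (INF e\<in>{0<..}. principal {(\<rho>, \<sigma>). dist \<rho> \<sigma> < e})"

definition open_predual :: "'a predual set \<Rightarrow> bool" where
  "open_predual W \<longleftrightarrow> (\<forall>\<rho>\<in>W. eventually (\<lambda>(\<rho>', \<sigma>). \<rho>' = \<rho> \<longrightarrow> \<sigma> \<in> W) uniformity)"

lemma norm_predual_le: "0 \<le> r \<Longrightarrow> \<rho> \<in> (*\<^sub>R) r ` unit_base \<Longrightarrow> norm \<rho> \<le> r"
  for \<rho> :: "'a predual"
  unfolding norm_predual_def by (rule cInf_lower) (auto intro: bdd_belowI[of _ 0])

lemma norm_predual_ge:
  fixes \<rho> :: "'a predual"
  assumes "\<And>r. 0 \<le> r \<Longrightarrow> \<rho> \<in> (*\<^sub>R) r ` unit_base \<Longrightarrow> c \<le> r"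
  shows "c \<le> norm \<rho>"
  unfolding norm_predual_def
  using assms unit_base_absorbing[of \<rho>] by (intro cInf_greatest) blast+

lemma fun_of_le_norm: "\<bar>fun_of \<rho> e\<bar> \<le> norm \<rho>" for \<rho> :: "'a predual"
proof (rule norm_predual_ge)
  fix r assume "0 \<le> r" "\<rho> \<in> (*\<^sub>R) r ` unit_base"
  then obtain \<sigma> where "\<rho> = r *\<^sub>R \<sigma>" "\<sigma> \<in> unit_base" by auto
  then show "\<bar>fun_of \<rho> e\<bar> \<le> r"
    using \<open>0 \<le> r\<close> mult_left_mono[OF unit_base_bound[of \<sigma> e] \<open>0 \<le> r\<close>] by (simp add: abs_mult)
qed

lemma norm_predual_scaleR_le: "norm (a *\<^sub>R \<rho>) \<le> \<bar>a\<bar> * norm \<rho>" for \<rho> :: "'a predual"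
proof (cases "a = 0")
  case True
  have "(0::'a predual) \<in> (*\<^sub>R) 0 ` unit_base"
    using unit_base_absorbing[of "0::'a predual"] by (auto simp: image_iff)
  then show ?thesis using norm_predual_le[of 0 "0::'a predual"] True by simp
next
  case False
  have "norm (a *\<^sub>R \<rho>) / \<bar>a\<bar> \<le> norm \<rho>"
  proof (rule norm_predual_ge)
    fix r assume r: "0 \<le> r" "\<rho> \<in> (*\<^sub>R) r ` unit_base"
    then obtain \<sigma> where \<sigma>: "\<rho> = r *\<^sub>R \<sigma>" "\<sigma> \<in> unit_base" by auto
    have "a *\<^sub>R \<rho> = (\<bar>a\<bar> * r) *\<^sub>R (if 0 \<le> a then \<sigma> else - \<sigma>)"
      using \<sigma>(1) by simp
    moreover have "(if 0 \<le> a then \<sigma> else - \<sigma>) \<in> unit_base"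
      using \<sigma>(2) unit_base_minus by auto
    ultimately have "a *\<^sub>R \<rho> \<in> (*\<^sub>R) (\<bar>a\<bar> * r) ` unit_base"
      by blast
    then have "norm (a *\<^sub>R \<rho>) \<le> \<bar>a\<bar> * r" using r by (intro norm_predual_le) auto
    then show "norm (a *\<^sub>R \<rho>) / \<bar>a\<bar> \<le> r" using False by (simp add: field_simps)
  qed
  then show ?thesis using False by (simp add: field_simps)
qed

instance
proof
  fix \<rho> \<sigma> :: "'a predual" and a :: real
  show "(norm \<rho> = 0) = (\<rho> = 0)"
  proof
    assume "norm \<rho> = 0"
    then show "\<rho> = 0" using fun_of_le_norm[of \<rho>] by (intro predual_eqI) simp
  next
    assume "\<rho> = 0"
    then show "norm \<rho> = 0"
      using norm_predual_scaleR_le[of 0 \<rho>] fun_of_le_norm[of \<rho> 1] by simp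
  qed
  show "norm (\<rho> + \<sigma>) \<le> norm \<rho> + norm \<sigma>"
  proof -
    have *: "norm (\<rho> + \<sigma>) \<le> r + q"
      if "0 \<le> r" "\<rho> \<in> (*\<^sub>R) r ` unit_base" "0 \<le> q" "\<sigma> \<in> (*\<^sub>R) q ` unit_base" for r q
      using that unit_base_combine by (intro norm_predual_le) auto
    have "norm (\<rho> + \<sigma>) - q \<le> norm \<rho>" if "0 \<le> q" "\<sigma> \<in> (*\<^sub>R) q ` unit_base" for q
      using *[OF _ _ that] by (intro norm_predual_ge) (simp add: diff_le_eq)
    then have "norm (\<rho> + \<sigma>) - norm \<rho> \<le> norm \<sigma>"
      by (intro norm_predual_ge) (simp add: algebra_simps)
    then show ?thesis by simp
  qed
  show "norm (a *\<^sub>R \<rho>) = \<bar>a\<bar> * norm \<rho>"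
  proof (cases "a = 0")
    case True
    then show ?thesis
      using norm_predual_scaleR_le[of 0 \<rho>] fun_of_le_norm[of "0 *\<^sub>R \<rho>" 1] by simp
  next
    case False
    then have "norm \<rho> \<le> \<bar>inverse a\<bar> * norm (a *\<^sub>R \<rho>)"
      using norm_predual_scaleR_le[of "inverse a" "a *\<^sub>R \<rho>"] by simp
    then show ?thesis
      using norm_predual_scaleR_le[of a \<rho>] False by (simp add: field_simps)
  qed
qed (simp_all add: dist_predual_def sgn_predual_def uniformity_predual_def open_predual_def)

end

text \<open>The norm of the library type of bounded linear functionals is the dual norm, so
  \<open>'e dual\<close> is the Banach space \<open>A = V\<^sup>*\<close>.\<close>

type_synonym 'e dual = "'e predual \<Rightarrow>\<^sub>L real"

lift_definition event :: "'e::jordan_ucp_space \<Rightarrow> 'e dual" is "\<lambda>e \<rho>. fun_of \<rho> e"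
  by (rule bounded_linear_intro[of _ 1]) (simp_all add: fun_of_le_norm)

definition weak_star :: "('v::real_normed_vector \<Rightarrow>\<^sub>L real) topology" where
  "weak_star = pullback_topology UNIV blinfun_apply (product_topology (\<lambda>_. euclideanreal) UNIV)"

section \<open>The operators \<open>U\<^sub>e\<close> and \<open>T\<^sub>e\<close>\<close>

text \<open>The number \<open>\<mu>(e) \<mu>\<^sub>e(x)\<close>, where \<open>\<mu>\<^sub>e\<close> acts on \<open>A\<close> by evaluation.\<close>

definition cond_weight :: "'e::jordan_ucp_space \<Rightarrow> 'e dual \<Rightarrow> ('e \<Rightarrow> real) \<Rightarrow> real" where
  "cond_weight e x \<mu> = (if \<mu> e = 0 then 0 else \<mu> e * blinfun_apply x (Abs_predual (cond \<mu> e)))"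

definition U_op :: "'e::jordan_ucp_space \<Rightarrow> 'e dual \<Rightarrow> 'e dual" where
  "U_op e x = (THE y. \<forall>\<mu>\<in>states. \<forall>\<nu>\<in>states. \<forall>s\<ge>0. \<forall>t\<ge>0.
     blinfun_apply y (s *\<^sub>R Abs_predual \<mu> - t *\<^sub>R Abs_predual \<nu>)
       = s * cond_weight e x \<mu> - t * cond_weight e x \<nu>)"

text \<open>The next lemmas, up to \<open>U_apply\<close>, show that \<open>U_op\<close> is well defined.\<close>

lemma cond_state:
  fixes \<mu> :: "'e::jordan_ucp_space \<Rightarrow> real"
  assumes "\<mu> \<in> states" "\<mu> e \<noteq> 0"
  shows "conditional_probability \<mu> e (cond \<mu> e)"
proof -
  have "0 \<le> \<mu> e" using assms by (auto simp: states_def)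
  then show ?thesis
    unfolding cond_def using assms by (intro theI'[OF UC2]) auto
qed

lemma cond_weight_affine:
  fixes \<mu> \<nu> \<omega> :: "'e::jordan_ucp_space \<Rightarrow> real"
  assumes st: "\<mu> \<in> states" "\<nu> \<in> states" "\<omega> \<in> states" "0 \<le> a" "0 \<le> b"
    and eq: "\<And>f. a * \<mu> f + b * \<nu> f = (a + b) * \<omega> f"
  shows "a * cond_weight e x \<mu> + b * cond_weight e x \<nu> = (a + b) * cond_weight e x \<omega>"
proof (cases "(a + b) * \<omega> e = 0")
  case True
  have "0 \<le> \<mu> e" "0 \<le> \<nu> e" using st by (auto simp: states_def)
  then have "a * \<mu> e = 0" "b * \<nu> e = 0"
    using True eq[of e] st by (auto simp: add_nonneg_eq_0_iff)
  then show ?thesis using True by (auto simp: cond_weight_def)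
next
  case False
  define m where "m = (if \<mu> e = 0 then \<mu> else cond \<mu> e)"
  define n where "n = (if \<nu> e = 0 then \<nu> else cond \<nu> e)"
  define p where "p = a * \<mu> e"
  define q where "q = b * \<nu> e"
  have nonneg: "0 \<le> \<mu> f" "0 \<le> \<nu> f" "0 \<le> \<omega> f" for f using st by (auto simp: states_def)
  have pq: "p + q = (a + b) * \<omega> e" "0 \<le> p" "0 \<le> q"
    using eq[of e] nonneg st by (auto simp: p_def q_def)
  have mn: "m \<in> states" "n \<in> states"
    using st cond_state unfolding m_def n_def conditional_probability_def by auto
  then obtain \<kappa> where \<kappa>: "\<kappa> \<in> states" "\<And>f. p * m f + q * n f = (p + q) * \<kappa> f"
    using states_combine[of m n p q] pq by blast
  have below: "\<eta> f = 0" if \<eta>: "\<eta> \<in> states" "\<eta> e = 0" "f \<bottom> compl e" for \<eta> :: "'e \<Rightarrow> real" and f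
  proof -
    obtain d where "f \<bottom> d" "f + d = e" using OS6[of f e] \<eta>(3) by auto
    then have "\<eta> f + \<eta> d = 0" "0 \<le> \<eta> f" "0 \<le> \<eta> d" using \<eta> by (auto simp: states_def)
    then show ?thesis by simp
  qed
  have "conditional_probability \<omega> e \<kappa>"
    unfolding conditional_probability_def
  proof (intro conjI allI impI)
    show "\<kappa> \<in> states" by (rule \<kappa>)
    fix f assume f: "f \<bottom> compl e"
    have "p * m f = a * \<mu> f"
      using cond_state[of \<mu> e] st f below[of \<mu> f]
      by (auto simp: p_def m_def conditional_probability_def)
    moreover have "q * n f = b * \<nu> f"
      using cond_state[of \<nu> e] st f below[of \<nu> f]
      by (auto simp: q_def n_def conditional_probability_def)
    ultimately have "(a + b) * \<omega> e * \<kappa> f = (a + b) * \<omega> f"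
      using \<kappa>(2)[of f] eq[of f] pq by auto
    then have "\<omega> e * \<kappa> f = \<omega> f" using False by auto
    moreover have "\<omega> e \<noteq> 0" using False by auto
    ultimately show "\<kappa> f = \<omega> f / \<omega> e" by (simp add: eq_divide_eq mult.commute)
  qed
  moreover have "\<omega> e > 0" using False nonneg(3)[of e] by (auto simp: less_le)
  ultimately have cond: "cond \<omega> e = \<kappa>"
    using UC2[OF st(3)] unfolding cond_def by (intro the1_equality) auto
  have "p *\<^sub>R Abs_predual m + q *\<^sub>R Abs_predual n = (p + q) *\<^sub>R Abs_predual \<kappa>"
    using mn \<kappa> by (intro predual_eqI) simp
  then have "blinfun_apply x (p *\<^sub>R Abs_predual m + q *\<^sub>R Abs_predual n)
      = blinfun_apply x ((p + q) *\<^sub>R Abs_predual \<kappa>)"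
    by simp
  then have "p * blinfun_apply x (Abs_predual m) + q * blinfun_apply x (Abs_predual n)
      = (p + q) * blinfun_apply x (Abs_predual \<kappa>)"
    by (simp add: blinfun.add_right blinfun.scaleR_right)
  moreover have "p * blinfun_apply x (Abs_predual m) = a * cond_weight e x \<mu>"
    "q * blinfun_apply x (Abs_predual n) = b * cond_weight e x \<nu>"
    by (auto simp: p_def q_def m_def n_def cond_weight_def)
  ultimately show ?thesis
    using False cond pq by (auto simp: cond_weight_def)
qed

lemma cond_weight_unique:
  fixes \<mu> \<nu> \<mu>' \<nu>' :: "'e::jordan_ucp_space \<Rightarrow> real"
  assumes st: "\<mu> \<in> states" "\<nu> \<in> states" "\<mu>' \<in> states" "\<nu>' \<in> states"
    and nonneg: "0 \<le> s" "0 \<le> t" "0 \<le> s'" "0 \<le> t'"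
    and eq: "\<And>f. s * \<mu> f - t * \<nu> f = s' * \<mu>' f - t' * \<nu>' f"
  shows "s * cond_weight e x \<mu> - t * cond_weight e x \<nu>
    = s' * cond_weight e x \<mu>' - t' * cond_weight e x \<nu>'"
proof -
  obtain \<omega> where \<omega>: "\<omega> \<in> states" "\<And>f. s * \<mu> f + t' * \<nu>' f = (s + t') * \<omega> f"
    using states_combine[of \<mu> \<nu>' s t'] st nonneg by blast
  have sum: "s + t' = s' + t" using eq[of 1] st by (auto simp: states_def)
  have "s' * \<mu>' f + t * \<nu> f = (s' + t) * \<omega> f" for f
    using \<omega>(2)[of f] eq[of f] unfolding sum by simp
  then have "s' * cond_weight e x \<mu>' + t * cond_weight e x \<nu> = (s' + t) * cond_weight e x \<omega>"
    using cond_weight_affine st nonneg \<omega>(1) by blast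
  moreover have "s * cond_weight e x \<mu> + t' * cond_weight e x \<nu>' = (s + t') * cond_weight e x \<omega>"
    using cond_weight_affine st nonneg \<omega> by blast
  ultimately show ?thesis unfolding sum by simp
qed

lemma predual_cases:
  fixes \<rho> :: "'e::jordan_ucp_space predual"
  obtains s t \<mu> \<nu> where "\<mu> \<in> states" "\<nu> \<in> states" "0 \<le> s" "0 \<le> t"
    "\<rho> = s *\<^sub>R Abs_predual \<mu> - t *\<^sub>R Abs_predual \<nu>"
proof -
  obtain s t \<mu> \<nu> where *: "\<mu> \<in> states" "\<nu> \<in> states" "0 \<le> s" "0 \<le> t"
    "fun_of \<rho> = (\<lambda>e. s * \<mu> e - t * \<nu> e)"
    by (rule fun_of_cases)
  then have "\<rho> = s *\<^sub>R Abs_predual \<mu> - t *\<^sub>R Abs_predual \<nu>" by (intro predual_eqI) simp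
  with * that show thesis by blast
qed

lemma U_exists:
  fixes e :: "'e::jordan_ucp_space" and x :: "'e dual"
  obtains y :: "'e dual" where
    "\<And>\<mu> \<nu> s t. \<lbrakk>\<mu> \<in> states; \<nu> \<in> states; 0 \<le> s; 0 \<le> t\<rbrakk> \<Longrightarrow>
      blinfun_apply y (s *\<^sub>R Abs_predual \<mu> - t *\<^sub>R Abs_predual \<nu>)
        = s * cond_weight e x \<mu> - t * cond_weight e x \<nu>"
proof -
  define F where "F \<rho> = (THE v. \<exists>s t \<mu> \<nu>. \<mu> \<in> states \<and> \<nu> \<in> states \<and> 0 \<le> s \<and> 0 \<le> t \<and>
      \<rho> = s *\<^sub>R Abs_predual \<mu> - t *\<^sub>R Abs_predual \<nu> \<and>
      v = s * cond_weight e x \<mu> - t * cond_weight e x \<nu>)" for \<rho> :: "'e predual"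
  have F: "F (s *\<^sub>R Abs_predual \<mu> - t *\<^sub>R Abs_predual \<nu>) = s * cond_weight e x \<mu> - t * cond_weight e x \<nu>"
    if st: "\<mu> \<in> states" "\<nu> \<in> states" "0 \<le> s" "0 \<le> t" for \<mu> \<nu> s t
    unfolding F_def
  proof (rule the_equality)
    show "\<exists>s' t' \<mu>' \<nu>'. \<mu>' \<in> states \<and> \<nu>' \<in> states \<and> 0 \<le> s' \<and> 0 \<le> t' \<and>
      s *\<^sub>R Abs_predual \<mu> - t *\<^sub>R Abs_predual \<nu> = s' *\<^sub>R Abs_predual \<mu>' - t' *\<^sub>R Abs_predual \<nu>' \<and>
      s * cond_weight e x \<mu> - t * cond_weight e x \<nu> = s' * cond_weight e x \<mu>' - t' * cond_weight e x \<nu>'"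
      using st by blast
    fix v
    assume "\<exists>s' t' \<mu>' \<nu>'. \<mu>' \<in> states \<and> \<nu>' \<in> states \<and> 0 \<le> s' \<and> 0 \<le> t' \<and>
      s *\<^sub>R Abs_predual \<mu> - t *\<^sub>R Abs_predual \<nu> = s' *\<^sub>R Abs_predual \<mu>' - t' *\<^sub>R Abs_predual \<nu>' \<and>
      v = s' * cond_weight e x \<mu>' - t' * cond_weight e x \<nu>'"
    then obtain s' t' \<mu>' \<nu>' where *: "\<mu>' \<in> states" "\<nu>' \<in> states" "0 \<le> s'" "0 \<le> t'"
      "s *\<^sub>R Abs_predual \<mu> - t *\<^sub>R Abs_predual \<nu> = s' *\<^sub>R Abs_predual \<mu>' - t' *\<^sub>R Abs_predual \<nu>'"
      "v = s' * cond_weight e x \<mu>' - t' * cond_weight e x \<nu>'"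
      by blast
    have "s * \<mu> f - t * \<nu> f = s' * \<mu>' f - t' * \<nu>' f" for f
    proof -
      have "fun_of (s *\<^sub>R Abs_predual \<mu> - t *\<^sub>R Abs_predual \<nu>) f
          = fun_of (s' *\<^sub>R Abs_predual \<mu>' - t' *\<^sub>R Abs_predual \<nu>') f"
        using *(5) by simp
      then show ?thesis using *(1,2) st by simp
    qed
    then show "v = s * cond_weight e x \<mu> - t * cond_weight e x \<nu>"
      unfolding *(6) by (intro cond_weight_unique) (use * st in auto)
  qed
  have add: "F (\<rho> + \<sigma>) = F \<rho> + F \<sigma>" for \<rho> \<sigma>
  proof -
    obtain s t \<mu> \<nu> where 1: "\<mu> \<in> states" "\<nu> \<in> states" "0 \<le> s" "0 \<le> t"
      "\<rho> = s *\<^sub>R Abs_predual \<mu> - t *\<^sub>R Abs_predual \<nu>"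
      by (rule predual_cases)
    obtain s' t' \<mu>' \<nu>' where 2: "\<mu>' \<in> states" "\<nu>' \<in> states" "0 \<le> s'" "0 \<le> t'"
      "\<sigma> = s' *\<^sub>R Abs_predual \<mu>' - t' *\<^sub>R Abs_predual \<nu>'"
      by (rule predual_cases)
    obtain \<omega> where 3: "\<omega> \<in> states" "\<And>e. s * \<mu> e + s' * \<mu>' e = (s + s') * \<omega> e"
      using states_combine[of \<mu> \<mu>' s s'] 1 2 by blast
    obtain \<omega>' where 4: "\<omega>' \<in> states" "\<And>e. t * \<nu> e + t' * \<nu>' e = (t + t') * \<omega>' e"
      using states_combine[of \<nu> \<nu>' t t'] 1 2 by blast
    have sum: "\<rho> + \<sigma> = (s + s') *\<^sub>R Abs_predual \<omega> - (t + t') *\<^sub>R Abs_predual \<omega>'"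
    proof (rule predual_eqI)
      fix f
      show "fun_of (\<rho> + \<sigma>) f = fun_of ((s + s') *\<^sub>R Abs_predual \<omega> - (t + t') *\<^sub>R Abs_predual \<omega>') f"
        using 1 2 3(1) 4(1) 3(2)[of f] 4(2)[of f] by simp
    qed
    have "F (\<rho> + \<sigma>) = (s + s') * cond_weight e x \<omega> - (t + t') * cond_weight e x \<omega>'"
      unfolding sum using 1 2 3(1) 4(1) by (intro F) auto
    also have "(s + s') * cond_weight e x \<omega> = s * cond_weight e x \<mu> + s' * cond_weight e x \<mu>'"
      using 1 2 3 by (intro cond_weight_affine[symmetric]) auto
    also have "(t + t') * cond_weight e x \<omega>' = t * cond_weight e x \<nu> + t' * cond_weight e x \<nu>'"
      using 1 2 4 by (intro cond_weight_affine[symmetric]) auto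
    finally show ?thesis using F 1 2 by simp
  qed
  have scale: "F (a *\<^sub>R \<rho>) = a * F \<rho>" for a \<rho>
  proof -
    obtain s t \<mu> \<nu> where 1: "\<mu> \<in> states" "\<nu> \<in> states" "0 \<le> s" "0 \<le> t"
      "\<rho> = s *\<^sub>R Abs_predual \<mu> - t *\<^sub>R Abs_predual \<nu>"
      by (rule predual_cases)
    show ?thesis
    proof (cases "0 \<le> a")
      case True
      have "a *\<^sub>R \<rho> = (a * s) *\<^sub>R Abs_predual \<mu> - (a * t) *\<^sub>R Abs_predual \<nu>"
        using 1 by (simp add: scaleR_right_diff_distrib)
      then show ?thesis
        using F[of \<mu> \<nu> "a * s" "a * t"] F[of \<mu> \<nu> s t] 1 True by (simp add: right_diff_distrib)
    next
      case False
      have "a *\<^sub>R \<rho> = (- a * t) *\<^sub>R Abs_predual \<nu> - (- a * s) *\<^sub>R Abs_predual \<mu>"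
        using 1 by (simp add: scaleR_right_diff_distrib)
      then have "F (a *\<^sub>R \<rho>) = (- a * t) * cond_weight e x \<nu> - (- a * s) * cond_weight e x \<mu>"
        using 1 False by (simp only:) (intro F, auto intro: mult_nonpos_nonneg)
      then show ?thesis
        using F[of \<mu> \<nu> s t] 1 by (simp add: right_diff_distrib)
    qed
  qed
  have state: "\<bar>F \<rho>\<bar> \<le> norm x" if "\<rho> \<in> state_points" for \<rho>
  proof -
    define \<mu> where "\<mu> = fun_of \<rho>"
    have \<mu>: "\<mu> \<in> states" "0 \<le> \<mu> e" "\<mu> e \<le> 1"
      using that by (auto simp: \<mu>_def state_points_def states_def)
    have "\<rho> = 1 *\<^sub>R Abs_predual \<mu> - 0 *\<^sub>R Abs_predual \<mu>"
      by (simp add: \<mu>_def fun_of_inverse)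
    then have F\<rho>: "F \<rho> = cond_weight e x \<mu>"
      using F[of \<mu> \<mu> 1 0] \<mu> by simp
    show ?thesis
    proof (cases "\<mu> e = 0")
      case True
      then show ?thesis by (simp add: F\<rho> cond_weight_def)
    next
      case False
      then have c: "cond \<mu> e \<in> states"
        using cond_state[of \<mu> e] \<mu> by (simp add: conditional_probability_def)
      then have "Abs_predual (cond \<mu> e) \<in> unit_base" by (intro hull_inc) simp
      then have "norm (Abs_predual (cond \<mu> e)) \<le> 1" by (intro norm_predual_le) auto
      then have "\<bar>blinfun_apply x (Abs_predual (cond \<mu> e))\<bar> \<le> norm x * 1"
        using norm_blinfun[of x "Abs_predual (cond \<mu> e)"]
          mult_left_mono[of "norm (Abs_predual (cond \<mu> e))" 1 "norm x"] by simp
      then have "\<mu> e * \<bar>blinfun_apply x (Abs_predual (cond \<mu> e))\<bar> \<le> 1 * norm x"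
        using \<mu> by (intro mult_mono) auto
      then show ?thesis using False \<mu> by (simp add: F\<rho> cond_weight_def abs_mult)
    qed
  qed
  have base: "\<bar>F \<rho>\<bar> \<le> norm x" if "\<rho> \<in> unit_base" for \<rho>
  proof -
    have "unit_base \<subseteq> {\<rho>. \<bar>F \<rho>\<bar> \<le> norm x}"
    proof (rule hull_minimal)
      have "F (- \<rho>) = - F \<rho>" for \<rho> using scale[of "- 1" \<rho>] by simp
      then show "state_points \<union> uminus ` state_points \<subseteq> {\<rho>. \<bar>F \<rho>\<bar> \<le> norm x}"
        using state by auto
      show "convex {\<rho>. \<bar>F \<rho>\<bar> \<le> norm x}"
      proof (rule convexI)
        fix \<rho> \<sigma> and u v :: real
        assume *: "\<rho> \<in> {\<rho>. \<bar>F \<rho>\<bar> \<le> norm x}" "\<sigma> \<in> {\<rho>. \<bar>F \<rho>\<bar> \<le> norm x}" "0 \<le> u" "0 \<le> v" "u + v = 1"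
        have "\<bar>u * F \<rho> + v * F \<sigma>\<bar> \<le> u * \<bar>F \<rho>\<bar> + v * \<bar>F \<sigma>\<bar>"
          using * by (intro order_trans[OF abs_triangle_ineq]) (simp add: abs_mult)
        also have "\<dots> \<le> u * norm x + v * norm x" using * by (intro add_mono mult_left_mono) auto
        also have "\<dots> = norm x" using * by (simp flip: distrib_right)
        finally show "u *\<^sub>R \<rho> + v *\<^sub>R \<sigma> \<in> {\<rho>. \<bar>F \<rho>\<bar> \<le> norm x}" by (simp add: add scale)
      qed
    qed
    with that show ?thesis by auto
  qed
  have bound: "\<bar>F \<rho>\<bar> \<le> norm \<rho> * norm x" for \<rho>
  proof (cases "norm x = 0")
    case True
    obtain r \<sigma> where "\<rho> = r *\<^sub>R \<sigma>" "\<sigma> \<in> unit_base" using unit_base_absorbing[of \<rho>] by auto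
    then show ?thesis using base[of \<sigma>] True by (simp add: scale)
  next
    case False
    have "\<bar>F \<rho>\<bar> / norm x \<le> norm \<rho>"
    proof (rule norm_predual_ge)
      fix r assume r: "0 \<le> r" "\<rho> \<in> (*\<^sub>R) r ` unit_base"
      then obtain \<sigma> where "\<rho> = r *\<^sub>R \<sigma>" "\<sigma> \<in> unit_base" by auto
      then have "\<bar>F \<rho>\<bar> \<le> r * norm x"
        using base[of \<sigma>] r(1) by (simp add: scale abs_mult mult_left_mono)
      then show "\<bar>F \<rho>\<bar> / norm x \<le> r" using False by (simp add: divide_le_eq)
    qed
    then show ?thesis using False by (simp add: divide_le_eq)
  qed
  have "bounded_linear F"
    by (rule bounded_linear_intro[of _ "norm x"]) (simp_all add: add scale bound)
  then have "blinfun_apply (Blinfun F) = F" by (rule bounded_linear_Blinfun_apply)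
  with F that[of "Blinfun F"] show thesis by simp
qed

lemma U_apply:
  fixes e :: "'e::jordan_ucp_space"
  assumes "\<mu> \<in> states" "\<nu> \<in> states" "0 \<le> s" "0 \<le> t"
  shows "blinfun_apply (U_op e x) (s *\<^sub>R Abs_predual \<mu> - t *\<^sub>R Abs_predual \<nu>)
    = s * cond_weight e x \<mu> - t * cond_weight e x \<nu>"
proof -
  let ?P = "\<lambda>y :: 'e dual. \<forall>\<mu>\<in>states. \<forall>\<nu>\<in>states. \<forall>s\<ge>0. \<forall>t\<ge>0.
     blinfun_apply y (s *\<^sub>R Abs_predual \<mu> - t *\<^sub>R Abs_predual \<nu>)
       = s * cond_weight e x \<mu> - t * cond_weight e x \<nu>"
  obtain y where y: "?P y"
  proof (rule U_exists[of e x])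
    fix y assume *: "\<And>\<mu> \<nu> s t. \<lbrakk>\<mu> \<in> states; \<nu> \<in> states; 0 \<le> s; 0 \<le> t\<rbrakk> \<Longrightarrow>
      blinfun_apply y (s *\<^sub>R Abs_predual \<mu> - t *\<^sub>R Abs_predual \<nu>)
        = s * cond_weight e x \<mu> - t * cond_weight e x \<nu>"
    show thesis by (rule that[of y]) (intro ballI allI impI *)
  qed
  have "z = y" if "?P z" for z
  proof (rule blinfun_eqI)
    fix \<rho> :: "'e predual"
    obtain s t \<mu> \<nu> where *: "\<mu> \<in> states" "\<nu> \<in> states" "0 \<le> s" "0 \<le> t"
      and \<rho>: "\<rho> = s *\<^sub>R Abs_predual \<mu> - t *\<^sub>R Abs_predual \<nu>"
      by (rule predual_cases)
    have "blinfun_apply z \<rho> = s * cond_weight e x \<mu> - t * cond_weight e x \<nu>"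
      unfolding \<rho> using that * by blast
    moreover have "blinfun_apply y \<rho> = s * cond_weight e x \<mu> - t * cond_weight e x \<nu>"
      unfolding \<rho> using y * by blast
    ultimately show "blinfun_apply z \<rho> = blinfun_apply y \<rho>" by simp
  qed
  with y have "?P (U_op e x)" unfolding U_op_def by (rule theI)
  with assms show ?thesis by blast
qed

definition T_op :: "'e::jordan_ucp_space \<Rightarrow> 'e dual \<Rightarrow> 'e dual" where
  "T_op e x = (1/2) *\<^sub>R (x + U_op e x - U_op (compl e) x)"

definition I3 :: "'e::jordan_ucp_space \<Rightarrow> 'e \<Rightarrow> 'e \<Rightarrow> 'e dual \<Rightarrow> 'e dual" where
  "I3 e1 e2 e3 x = U_op (e1 + e2 + e3) x - U_op (e1 + e2) x - U_op (e2 + e3) x - U_op (e1 + e3) x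
     + U_op e1 x + U_op e2 x + U_op e3 x"

end

theory Submission
  imports Defs
begin

text \<open>For fixed \<open>x\<close> the hypothesis on \<open>I\<^sub>3\<close>, applied to \<open>e\<close>, \<open>f\<close> and \<open>(e + f)'\<close>, says precisely that
  \<open>e \<mapsto> T\<^sub>e x\<close> is orthogonally additive. Hence, for \<open>\<rho> \<in> V\<close>, the function
  \<open>e \<mapsto> (T\<^sub>e x)(\<rho>)\<close> is bounded and orthogonally additive, so by the Jordan decomposition property it
  is an element \<open>T\<^sup>*\<rho>\<close> of \<open>V\<close>; the extension is \<open>y \<mapsto> y \<circ> T\<^sup>*\<close>. Boundedness of \<open>T\<^sup>*\<close> comes
  from a Baire category argument: the sets of all \<open>s\<mu> - t\<nu>\<close> with \<open>s, t \<le> n\<close> are compact for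
  pointwise convergence and exhaust the bounded orthogonally additive functions, so one of them
  contains a ball of the supremum norm, which is therefore equivalent to the base norm.
  Uniqueness holds because a \<open>\<sigma>(A,V)\<close>-continuous functional on \<open>A\<close> is the evaluation at an element
  of \<open>V\<close>, and elements of \<open>V\<close> are determined by their values on events.\<close>

section \<open>Orthogonal additivity of \<open>e \<mapsto> T\<^sub>e x\<close>\<close>

lemma compl_eqI: "compl e = f" if "e \<bottom> f" "e + f = 1" for e f :: "'e::quantum_logic"
  unfolding compl_def using that OS5 by (intro the1_equality) auto

lemma compl_orth: "e \<bottom> compl e" and plus_compl: "e + compl e = 1"
  for e :: "'e::quantum_logic"
  using theI'[OF OS5[of e]] by (auto simp: compl_def)

lemma compl_one: "compl 1 = (0 :: 'e::quantum_logic)"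
  using OS4 OS1 by (intro compl_eqI) auto

text \<open>By (OS6) with \<open>f\<close>, respectively \<open>e\<close>, as the missing summand,
  \<open>e\<close>, \<open>f\<close> and \<open>compl (e + f)\<close> form an orthogonal triple. Its
  sum is 1, so uniqueness in (OS5) makes the complement of each of \<open>e\<close> and
  \<open>f\<close> the sum of the other two members.\<close>

lemma orth_compl_plus:
  fixes e f :: "'e::quantum_logic"
  assumes "e \<bottom> f"
  shows "e \<bottom> compl (e + f)" "f \<bottom> compl (e + f)"
    and "compl e = f + compl (e + f)" "compl f = e + compl (e + f)"
proof -
  let ?g = "compl (e + f)"
  show eg: "e \<bottom> ?g" using OS6 assms by blast
  show fg: "f \<bottom> ?g" using OS6 OS1[OF assms] OS2[OF assms] by metis
  show "compl e = f + ?g"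
    using OS3[OF assms eg fg] plus_compl[of "e + f"] by (intro compl_eqI) auto
  show "compl f = e + ?g"
    using OS3[OF OS1[OF assms] fg eg] plus_compl[of "e + f"] OS2[OF assms]
    by (intro compl_eqI) auto
qed

text \<open>Since 1' = 0 is orthogonal to every event, the defining formula of a conditional
  probability under 1 applies to all events and returns \<mu> itself.\<close>

lemma cond_weight_one:
  fixes \<mu> :: "'e::jordan_ucp_space \<Rightarrow> real"
  assumes "\<mu> \<in> states"
  shows "cond_weight 1 x \<mu> = blinfun_apply x (Abs_predual \<mu>)"
proof -
  have \<mu>1: "\<mu> 1 = 1" using assms by (simp add: states_def)
  then have "conditional_probability \<mu> 1 (cond \<mu> 1)" using cond_state[OF assms, of 1] by simp
  moreover have "f \<bottom> compl 1" for f :: 'e using OS1 OS4 by (metis compl_one)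
  ultimately have "cond \<mu> 1 = \<mu>" using \<mu>1 by (auto simp: conditional_probability_def)
  then show ?thesis using \<mu>1 by (simp add: cond_weight_def)
qed

lemma U_op_one: "U_op 1 x = x" for x :: "'e::jordan_ucp_space dual"
proof (rule blinfun_eqI)
  fix \<rho> :: "'e predual"
  obtain s t \<mu> \<nu> where "\<mu> \<in> states" "\<nu> \<in> states" "0 \<le> s" "0 \<le> t"
    "\<rho> = s *\<^sub>R Abs_predual \<mu> - t *\<^sub>R Abs_predual \<nu>"
    by (rule predual_cases)
  then show "blinfun_apply (U_op 1 x) \<rho> = blinfun_apply x \<rho>"
    using U_apply[of \<mu> \<nu> s t 1 x]
    by (simp add: cond_weight_one blinfun.diff_right blinfun.scaleR_right)
qed

lemma T_op_additive:
  fixes x :: "'e::jordan_ucp_space dual"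
  assumes I3: "\<And>e1 e2 e3 :: 'e. \<lbrakk>e1 \<bottom> e2; e2 \<bottom> e3; e1 \<bottom> e3\<rbrakk> \<Longrightarrow> I3 e1 e2 e3 = (\<lambda>_. 0)"
    and ef: "e \<bottom> f"
  shows "T_op (e + f) x = T_op e x + T_op f x"
proof -
  let ?g = "compl (e + f)"
  note g = orth_compl_plus[OF ef]
  have "I3 e f ?g x = 0" using I3[OF ef g(2,1)] by simp
  \<comment> \<open>The triple sums to 1 and \<open>U_op 1\<close> is the identity; the pair sums
    \<open>f + ?g\<close> and \<open>e + ?g\<close> are the complements of \<open>e\<close> and
    \<open>f\<close>.\<close>
  then have "x - U_op (e + f) x - U_op (compl e) x - U_op (compl f) x
      + U_op e x + U_op f x + U_op ?g x = 0"
    by (simp add: I3_def plus_compl U_op_one g(3,4))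
  then have "x + U_op (e + f) x - U_op ?g x
      = (x + U_op e x - U_op (compl e) x) + (x + U_op f x - U_op (compl f) x)"
    by (simp add: algebra_simps)
  then show ?thesis unfolding T_op_def by (simp only: scaleR_right_distrib)
qed

section \<open>Bounds in the base norm\<close>

lemma norm_Abs_state_le: "norm (Abs_predual \<mu>) \<le> 1"
  if "\<mu> \<in> states" for \<mu> :: "'e::jordan_ucp_space \<Rightarrow> real"
  using that by (intro norm_predual_le) (auto intro: hull_inc)

text \<open>The base norm is the gauge of \<open>unit_base\<close>, the convex hull of the states
  and their negatives; a symmetric bound by a linear functional passes from the states to this
  hull.\<close>

lemma norm_dual_le:
  fixes y :: "'e::jordan_ucp_space dual"
  assumes y: "\<And>\<mu>. \<mu> \<in> states \<Longrightarrow> \<bar>blinfun_apply y (Abs_predual \<mu>)\<bar> \<le> c"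
  shows "norm y \<le> c"
proof (rule norm_blinfun_bound)
  show c: "0 \<le> c" using states_nonempty y by (metis abs_ge_zero all_not_in_conv order_trans)
  fix \<rho> :: "'e predual"
  have "unit_base \<subseteq> blinfun_apply y -` {- c..c}"
  proof (rule hull_minimal)
    have "\<bar>blinfun_apply y \<sigma>\<bar> \<le> c" if "\<sigma> \<in> state_points" for \<sigma>
      using y[of "fun_of \<sigma>"] that by (simp add: state_points_def fun_of_inverse)
    then show "state_points \<union> uminus ` state_points \<subseteq> blinfun_apply y -` {- c..c}"
      by (force simp: abs_le_iff blinfun.minus_right)
    show "convex (blinfun_apply y -` {- c..c})"
      by (intro convex_linear_vimage bounded_linear.linear blinfun.bounded_linear_right) simp
  qed
  then have base: "\<bar>blinfun_apply y \<sigma>\<bar> \<le> c" if "\<sigma> \<in> unit_base" for \<sigma>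
    using that by fastforce
  have scaled: "\<bar>blinfun_apply y \<rho>\<bar> \<le> r * c" if "0 \<le> r" "\<rho> \<in> (*\<^sub>R) r ` unit_base" for r
    using that base by (auto simp: blinfun.scaleR_right abs_mult mult_left_mono)
  show "norm (blinfun_apply y \<rho>) \<le> c * norm \<rho>"
  \<comment> \<open>\<open>norm_predual_ge\<close> bounds the norm below by a lower bound of the
    admissible \<open>r\<close>; that bound arises on division by \<open>c\<close>.\<close>
  proof (cases "c = 0")
    case True
    then show ?thesis
      using unit_base_absorbing[of \<rho>] scaled by force
  next
    case False
    then have "\<bar>blinfun_apply y \<rho>\<bar> / c \<le> norm \<rho>"
      using c scaled
      by (intro norm_predual_ge) (simp add: divide_le_eq)
    then show ?thesis using c False by (simp add: divide_le_eq mult.commute)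
  qed
qed

text \<open>On a state the value is \<mu>(e) times the value of \<open>x\<close> at the state
  \<mu>_e, where \<mu>(e) \<le> 1 and states have norm at most 1.\<close>

lemma norm_U_op_le: "norm (U_op e x) \<le> norm x" for x :: "'e::jordan_ucp_space dual"
proof (rule norm_dual_le)
  fix \<mu> :: "'e \<Rightarrow> real" assume \<mu>: "\<mu> \<in> states"
  then have e: "0 \<le> \<mu> e" "\<mu> e \<le> 1" by (auto simp: states_def)
  have "\<bar>cond_weight e x \<mu>\<bar> \<le> norm x"
  proof (cases "\<mu> e = 0")
    case False
    let ?\<kappa> = "Abs_predual (cond \<mu> e)"
    have "norm ?\<kappa> \<le> 1"
      using cond_state[OF \<mu> False] by (intro norm_Abs_state_le) (simp add: conditional_probability_def)
    then have "\<bar>blinfun_apply x ?\<kappa>\<bar> \<le> norm x"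
      using norm_blinfun[of x ?\<kappa>] mult_left_le[of "norm ?\<kappa>" "norm x"] by simp
    then have "\<mu> e * \<bar>blinfun_apply x ?\<kappa>\<bar> \<le> 1 * norm x" using e by (intro mult_mono) auto
    then show ?thesis using e by (simp add: cond_weight_def abs_mult)
  qed (simp add: cond_weight_def)
  then show "\<bar>blinfun_apply (U_op e x) (Abs_predual \<mu>)\<bar> \<le> norm x"
    using U_apply[OF \<mu> \<mu>, of 1 0 e x] by simp
qed

text \<open>The triangle inequality gives the factor 3/2, rounded up to 2; what matters later is
  uniformity in \<open>e\<close>.\<close>

lemma norm_T_op_le: "norm (T_op e x) \<le> 2 * norm x" for x :: "'e::jordan_ucp_space dual"
proof -
  have "norm (x + U_op e x - U_op (compl e) x) \<le> norm x + norm x + norm x"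
    using norm_triangle_ineq4[of "x + U_op e x" "U_op (compl e) x"] norm_triangle_ineq[of x "U_op e x"]
      norm_U_op_le[of e x] norm_U_op_le[of "compl e" x] by linarith
  then show ?thesis using norm_ge_zero[of x] unfolding T_op_def norm_scaleR by linarith
qed

section \<open>Equivalence of the base norm and the supremum norm\<close>

text \<open>By Tychonoff the cube [0,1]^E is compact for pointwise convergence, and the state axioms
  are closed conditions on finitely many coordinates each.\<close>

lemma compact_states: "compact (states :: ('e::partial_sum \<Rightarrow> real) set)"
proof -
  have "compactin (product_topology (\<lambda>_. euclideanreal) UNIV) (PiE UNIV (\<lambda>_. {0..1}) :: ('e \<Rightarrow> real) set)"
    by (subst compactin_PiE) simp
  then have "compact (PiE UNIV (\<lambda>_. {0..1}) :: ('e \<Rightarrow> real) set)"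
    by (simp add: euclidean_product_topology)
  moreover have "closed {\<mu> :: 'e \<Rightarrow> real. \<mu> 1 = 1 \<and> (\<forall>e f. e \<bottom> f \<longrightarrow> \<mu> (e + f) = \<mu> e + \<mu> f)}"
    by (intro closed_Collect_conj closed_Collect_all closed_Collect_imp open_Collect_const
        closed_Collect_eq continuous_intros continuous_on_product_coordinates)
  ultimately have "compact (PiE UNIV (\<lambda>_. {0..1}) \<inter>
      {\<mu> :: 'e \<Rightarrow> real. \<mu> 1 = 1 \<and> (\<forall>e f. e \<bottom> f \<longrightarrow> \<mu> (e + f) = \<mu> e + \<mu> f)})"
    by (rule compact_Int_closed)
  also have "\<dots> = states" by (auto simp: states_def PiE_UNIV_domain)
  finally show ?thesis .
qed

text \<open>Written as the image of a product of compact sets, so that compactness follows from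
  continuity of the parametrization.\<close>

definition jordan_ball :: "real \<Rightarrow> ('e::partial_sum \<Rightarrow> real) set" where
  "jordan_ball r = (\<lambda>(s, t, \<mu>, \<nu>) e. s * \<mu> e - t * \<nu> e) ` ({0..r} \<times> {0..r} \<times> states \<times> states)"

lemma jordan_ballI:
  "\<mu> \<in> states \<Longrightarrow> \<nu> \<in> states \<Longrightarrow> s \<in> {0..r} \<Longrightarrow> t \<in> {0..r} \<Longrightarrow> (\<And>e. h e = s * \<mu> e - t * \<nu> e)
    \<Longrightarrow> h \<in> jordan_ball r"
  unfolding jordan_ball_def by (rule image_eqI[of _ _ "(s, t, \<mu>, \<nu>)"]) auto

lemma jordan_ballE:
  assumes "h \<in> jordan_ball r"
  obtains s t \<mu> \<nu> where "\<mu> \<in> states" "\<nu> \<in> states" "s \<in> {0..r}" "t \<in> {0..r}"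
    "\<And>e. h e = s * \<mu> e - t * \<nu> e"
  using assms unfolding jordan_ball_def by auto

lemma closed_jordan_ball: "closed (jordan_ball r :: ('e::partial_sum \<Rightarrow> real) set)"
proof -
  let ?D = "{0..r} \<times> {0..r} \<times> (states :: ('e \<Rightarrow> real) set) \<times> (states :: ('e \<Rightarrow> real) set)"
  have "continuous_on ?D (\<lambda>p. fst (snd (snd p)) e)" "continuous_on ?D (\<lambda>p. snd (snd (snd p)) e)" for e
    by (rule continuous_on_product_then_coordinatewise, intro continuous_intros)+
  then have "compact (jordan_ball r :: ('e \<Rightarrow> real) set)"
    unfolding jordan_ball_def case_prod_unfold
    by (intro compact_continuous_image compact_Times compact_Icc compact_states
        continuous_on_coordinatewise_then_product continuous_intros)
  moreover have "Hausdorff_space (euclidean :: ('e \<Rightarrow> real) topology)"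
    by (simp add: Hausdorff_space_product_topology flip: euclidean_product_topology)
  ultimately show ?thesis using compactin_imp_closedin by fastforce
qed

text \<open>Subtraction exchanges positive and negative parts, so \<mu> merges with \<nu>' and \<nu>
  with \<mu>'; the coefficients add.\<close>

lemma jordan_ball_diff:
  fixes g h :: "'e::partial_sum \<Rightarrow> real"
  assumes "g \<in> jordan_ball r" "h \<in> jordan_ball q"
  shows "(\<lambda>e. g e - h e) \<in> jordan_ball (r + q)"
proof -
  obtain s t \<mu> \<nu> where 1: "\<mu> \<in> states" "\<nu> \<in> states" "s \<in> {0..r}" "t \<in> {0..r}"
    "\<And>e. g e = s * \<mu> e - t * \<nu> e" by (rule jordan_ballE[OF assms(1)]) blast
  obtain s' t' \<mu>' \<nu>' where 2: "\<mu>' \<in> states" "\<nu>' \<in> states" "s' \<in> {0..q}" "t' \<in> {0..q}"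
    "\<And>e. h e = s' * \<mu>' e - t' * \<nu>' e" by (rule jordan_ballE[OF assms(2)]) blast
  obtain \<omega> where 3: "\<omega> \<in> states" "\<And>e. s * \<mu> e + t' * \<nu>' e = (s + t') * \<omega> e"
    using states_combine[of \<mu> \<nu>' s t'] 1 2 by auto
  obtain \<omega>' where 4: "\<omega>' \<in> states" "\<And>e. t * \<nu> e + s' * \<mu>' e = (t + s') * \<omega>' e"
    using states_combine[of \<nu> \<mu>' t s'] 1 2 by auto
  show ?thesis
  proof (rule jordan_ballI[OF 3(1) 4(1)])
    show "g e - h e = (s + t') * \<omega> e - (t + s') * \<omega>' e" for e
      using 1(5)[of e] 2(5)[of e] 3(2)[of e] 4(2)[of e] by linarith
  qed (use 1 2 in auto)
qed

lemma jordan_ball_scale: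
  fixes h :: "'e::partial_sum \<Rightarrow> real"
  assumes "h \<in> jordan_ball r" "0 \<le> a"
  shows "(\<lambda>e. a * h e) \<in> jordan_ball (a * r)"
proof -
  obtain s t \<mu> \<nu> where 1: "\<mu> \<in> states" "\<nu> \<in> states" "s \<in> {0..r}" "t \<in> {0..r}"
    "\<And>e. h e = s * \<mu> e - t * \<nu> e" by (rule jordan_ballE[OF assms(1)]) blast
  show ?thesis
    by (rule jordan_ballI[OF 1(1,2), of "a * s" _ "a * t"])
      (use 1 assms(2) in \<open>auto simp: mult_left_mono right_diff_distrib\<close>)
qed

text \<open>Otherwise members of the ball would approximate \<open>g\<close> uniformly, hence
  pointwise, and pointwise closedness would put \<open>g\<close> into the ball.\<close>

lemma jordan_ball_closed_uniformly:
  fixes g :: "'e::partial_sum \<Rightarrow> real"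
  assumes "g \<notin> jordan_ball r"
  obtains \<delta> where "\<delta> > 0" "\<And>h. (\<And>e. \<bar>h e - g e\<bar> \<le> \<delta>) \<Longrightarrow> h \<notin> jordan_ball r"
proof (rule ccontr)
  assume "\<not> thesis"
  then have "\<forall>\<delta>>0. \<exists>h\<in>jordan_ball r. \<forall>e. \<bar>h e - g e\<bar> \<le> \<delta>" using that by blast
  then have "\<forall>n. \<exists>h\<in>jordan_ball r. \<forall>e. \<bar>h e - g e\<bar> \<le> inverse (real (Suc n))" by simp
  then obtain h where h: "\<And>n. h n \<in> jordan_ball r"
    "\<And>n e. \<bar>h n e - g e\<bar> \<le> inverse (real (Suc n))"
    by metis
  have "(\<lambda>n. h n e) \<longlonglongrightarrow> g e" for e
  proof (rule LIM_zero_cancel, rule Lim_null_comparison)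
    show "\<forall>\<^sub>F n in sequentially. norm (h n e - g e) \<le> inverse (real (Suc n))"
      using h(2) by simp
    show "(\<lambda>n. inverse (real (Suc n))) \<longlonglongrightarrow> 0" by (rule LIMSEQ_inverse_real_of_nat)
  qed
  then have "limitin (product_topology (\<lambda>_. euclidean) UNIV) h g sequentially"
    by (simp add: limitin_componentwise)
  then have "h \<longlonglongrightarrow> g" by (simp add: euclidean_product_topology)
  then have "g \<in> jordan_ball r" using h(1) closed_sequentially[OF closed_jordan_ball] by blast
  with assms show False by simp
qed

section \<open>Baire category argument for the Jordan balls\<close>

definition orth_additive :: "('e::partial_sum \<Rightarrow> real) \<Rightarrow> bool" where
  "orth_additive h \<longleftrightarrow> (\<forall>e f. e \<bottom> f \<longrightarrow> h (e + f) = h e + h f)"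

text \<open>The covering half of the Baire argument: by the Jordan decomposition property the balls
  of integer radius exhaust the bounded orthogonally additive functions.\<close>

lemma orth_additive_in_jordan_ball:
  fixes h :: "'e::jordan_ucp_space \<Rightarrow> real"
  assumes "orth_additive h" "bounded (range h)"
  obtains n :: nat where "\<And>m. m \<ge> n \<Longrightarrow> h \<in> jordan_ball (real m)"
proof -
  obtain s t \<mu> \<nu> where *: "\<mu> \<in> states" "\<nu> \<in> states" "0 \<le> s" "0 \<le> t" "h = (\<lambda>e. s * \<mu> e - t * \<nu> e)"
    using Jordan_decomposition[of h] assms unfolding orth_additive_def by blast
  obtain n :: nat where "max s t \<le> real n" using real_arch_simple by blast
  then have "h \<in> jordan_ball (real m)" if "m \<ge> n" for m
    using * that by (intro jordan_ballI[OF *(1,2), of s _ t]) auto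
  then show thesis by (rule that)
qed

text \<open>One Baire step: if no Jordan ball absorbs the unit ball of the supremum norm, then each
  has empty interior, so an arbitrarily small move leaves it, and a whole small ball around the new
  centre stays outside.\<close>

lemma escape_jordan_ball:
  fixes g :: "'e::jordan_ucp_space \<Rightarrow> real"
  assumes unabsorbed: "\<And>r. \<exists>h. orth_additive h \<and> (\<forall>e. \<bar>h e\<bar> \<le> 1) \<and> h \<notin> (jordan_ball r :: ('e \<Rightarrow> real) set)"
    and g: "orth_additive g" and "\<epsilon> > 0"
  obtains g' \<delta> where "orth_additive g'" "\<And>e. \<bar>g' e - g e\<bar> \<le> \<epsilon>" "0 < \<delta>" "\<delta> \<le> \<epsilon>"
    "\<And>h. (\<And>e. \<bar>h e - g' e\<bar> \<le> \<delta>) \<Longrightarrow> h \<notin> jordan_ball r"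
proof -
  obtain g' where g': "orth_additive g'" "\<And>e. \<bar>g' e - g e\<bar> \<le> \<epsilon>" "g' \<notin> jordan_ball r"
  proof (cases "g \<in> jordan_ball r")
    case False
    then show ?thesis using that[of g] g \<open>\<epsilon> > 0\<close> by simp
  next
    case True
    \<comment> \<open>If both \<open>g\<close> and \<open>g + \<epsilon> h\<close> lay in the ball
      of radius \<open>r\<close>, their difference \<open>\<epsilon> h\<close> would lie in that of
      radius \<open>2 r\<close>; hence the radius \<open>2 r / \<epsilon>\<close> for
      \<open>h\<close>.\<close>
    obtain h :: "'e \<Rightarrow> real" where h: "orth_additive h" "\<And>e. \<bar>h e\<bar> \<le> 1" "h \<notin> jordan_ball ((1 / \<epsilon>) * (r + r))"
      using unabsorbed[of "(1 / \<epsilon>) * (r + r)"] by blast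
    show ?thesis
    proof (rule that)
      show "orth_additive (\<lambda>e. g e + \<epsilon> * h e)"
        using g h(1) by (simp add: orth_additive_def algebra_simps)
      show "\<bar>(g e + \<epsilon> * h e) - g e\<bar> \<le> \<epsilon>" for e
        using h(2)[of e] \<open>\<epsilon> > 0\<close> by (simp add: abs_mult mult_left_le)
      show "(\<lambda>e. g e + \<epsilon> * h e) \<notin> jordan_ball r"
      proof
        assume "(\<lambda>e. g e + \<epsilon> * h e) \<in> jordan_ball r"
        from jordan_ball_scale[OF jordan_ball_diff[OF this True], of "1 / \<epsilon>"]
        have "(\<lambda>e. (1 / \<epsilon>) * (\<epsilon> * h e)) \<in> jordan_ball ((1 / \<epsilon>) * (r + r))"
          using \<open>\<epsilon> > 0\<close> by simp
        then show False using h(3) \<open>\<epsilon> > 0\<close> by simp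
      qed
    qed
  qed
  obtain \<delta> where "\<delta> > 0" "\<And>h. (\<And>e. \<bar>h e - g' e\<bar> \<le> \<delta>) \<Longrightarrow> h \<notin> jordan_ball r"
    using jordan_ball_closed_uniformly[OF g'(3)] by blast
  then show thesis
    using \<open>\<epsilon> > 0\<close> by (intro that[OF g'(1,2), of "min \<delta> \<epsilon>"]) auto
qed

lemma sup_norm_ball_subset_jordan_ball:
  "\<exists>r. \<forall>h :: 'e::jordan_ucp_space \<Rightarrow> real.
    orth_additive h \<longrightarrow> (\<forall>e. \<bar>h e\<bar> \<le> 1) \<longrightarrow> h \<in> jordan_ball r"
proof (rule ccontr)
  assume "\<not> ?thesis"
  then have un: "\<exists>h. orth_additive h \<and> (\<forall>e. \<bar>h e\<bar> \<le> 1) \<and> h \<notin> (jordan_ball r :: ('e \<Rightarrow> real) set)" for r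
    by blast
  \<comment> \<open>A pair codes a closed ball of the supremum norm by centre and radius.
    \<open>Q n p q\<close> places the ball \<open>q\<close> inside \<open>p\<close> and makes it
    disjoint from the Jordan ball of radius \<open>n\<close>.\<close>
  define P where "P p \<longleftrightarrow> orth_additive (fst p) \<and> 0 < snd p" for p :: "('e \<Rightarrow> real) \<times> real"
  define Q where "Q n p q \<longleftrightarrow> (\<forall>e. \<bar>fst q e - fst p e\<bar> \<le> snd p / 2) \<and> snd q \<le> snd p / 2 \<and>
    (\<forall>h. (\<forall>e. \<bar>h e - fst q e\<bar> \<le> snd q) \<longrightarrow> h \<notin> jordan_ball (real n))"
    for n and p q :: "('e \<Rightarrow> real) \<times> real"
  \<comment> \<open>The clause for \<open>n = 0\<close> fixes the unit ball around 0 as the start,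
    from which boundedness of the limit will follow.\<close>
  have "\<exists>F. \<forall>n. (P (F n) \<and> (n = 0 \<longrightarrow> F n = (\<lambda>_. 0, 1))) \<and> Q n (F n) (F (Suc n))"
  proof (rule dependent_nat_choice)
    show "\<exists>p. P p \<and> (0 = (0::nat) \<longrightarrow> p = (\<lambda>_. 0, 1))" by (simp add: P_def orth_additive_def)
    fix p n assume "P p \<and> (n = (0::nat) \<longrightarrow> p = (\<lambda>_. 0, 1))"
    then have "orth_additive (fst p)" "snd p / 2 > 0" by (auto simp: P_def)
    from escape_jordan_ball[OF un this, of "real n"] obtain g \<delta> where
      "orth_additive g" "\<And>e. \<bar>g e - fst p e\<bar> \<le> snd p / 2" "0 < \<delta>" "\<delta> \<le> snd p / 2"
      "\<And>h. (\<And>e. \<bar>h e - g e\<bar> \<le> \<delta>) \<Longrightarrow> h \<notin> jordan_ball (real n)"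
      by metis
    then show "\<exists>q. (P q \<and> (Suc n = 0 \<longrightarrow> q = (\<lambda>_. 0, 1))) \<and> Q n p q"
      by (intro exI[of _ "(g, \<delta>)"]) (simp add: P_def Q_def)
  qed
  then obtain F where F: "\<And>n. P (F n)" "\<And>n. Q n (F n) (F (Suc n))" and F0: "F 0 = (\<lambda>_. 0, 1)"
    by blast
  define g where "g n = fst (F n)" for n
  define \<epsilon> where "\<epsilon> n = snd (F n)" for n
  have add: "orth_additive (g n)" and \<epsilon>_pos: "0 < \<epsilon> n" for n
    using F(1)[of n] by (auto simp: P_def g_def \<epsilon>_def)
  have step: "\<bar>g (Suc n) e - g n e\<bar> \<le> \<epsilon> n / 2" and \<epsilon>_step: "\<epsilon> (Suc n) \<le> \<epsilon> n / 2"
    and avoid: "(\<And>e. \<bar>h e - g (Suc n) e\<bar> \<le> \<epsilon> (Suc n)) \<Longrightarrow> h \<notin> jordan_ball (real n)" for n e h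
    using F(2)[of n] by (auto simp: Q_def g_def \<epsilon>_def)
  \<comment> \<open>Telescoping: each move is at most half the radius, which is at most the decrease
    from \<open>\<epsilon> n\<close> to \<open>\<epsilon> (Suc n)\<close>.\<close>
  have near: "\<bar>g (n + k) e - g n e\<bar> \<le> \<epsilon> n - \<epsilon> (n + k)" for n k e
  proof (induction k)
    case (Suc k)
    then show ?case using step[of "n + k" e] \<epsilon>_step[of "n + k"] unfolding add_Suc_right by linarith
  qed simp
  have \<epsilon>_le: "\<epsilon> n \<le> \<epsilon> 0 * (1 / 2) ^ n" for n
  proof (induction n)
    case (Suc n)
    then show ?case using \<epsilon>_step[of n] by simp
  qed simp
  have \<epsilon>_lim: "\<epsilon> \<longlonglongrightarrow> 0"
  proof (rule Lim_null_comparison)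
    show "\<forall>\<^sub>F n in sequentially. norm (\<epsilon> n) \<le> \<epsilon> 0 * (1 / 2) ^ n"
      using \<epsilon>_le \<epsilon>_pos by (simp add: less_imp_le)
    show "(\<lambda>n. \<epsilon> 0 * (1 / 2) ^ n) \<longlonglongrightarrow> 0"
      by (intro tendsto_mult_right_zero LIMSEQ_realpow_zero) auto
  qed
  have near': "\<bar>g m e - g n e\<bar> \<le> \<epsilon> n" if "m \<ge> n" for m n e
    using near[of n "m - n" e] \<epsilon>_pos[of m] that by simp
  have "Cauchy (\<lambda>n. g n e)" for e
  proof (rule CauchyI')
    fix \<eta> :: real assume "\<eta> > 0"
    then have "\<forall>\<^sub>F n in sequentially. \<epsilon> n < \<eta>" using order_tendstoD(2)[OF \<epsilon>_lim] by blast
    then obtain N where N: "\<And>n. n \<ge> N \<Longrightarrow> \<epsilon> n < \<eta>" by (auto simp: eventually_sequentially)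
    have "norm (g m e - g n e) < \<eta>" if "m \<ge> N" "m < n" for m n
      using near'[of m n e] N[of m] that by (simp add: abs_minus_commute)
    then show "\<exists>M. \<forall>m\<ge>M. \<forall>n>m. dist (g m e) (g n e) < \<eta>" by (auto simp: dist_norm)
  qed
  then have "\<exists>l. (\<lambda>n. g n e) \<longlonglongrightarrow> l" for e using Cauchy_convergent convergent_def by blast
  then obtain h where lim: "\<And>e. (\<lambda>n. g n e) \<longlonglongrightarrow> h e" by metis
  \<comment> \<open>Letting \<open>m\<close> tend to infinity keeps the limit in every closed ball
    of the sequence.\<close>
  have h: "\<bar>h e - g n e\<bar> \<le> \<epsilon> n" for n e
  proof (rule tendsto_upperbound)
    show "(\<lambda>m. \<bar>g m e - g n e\<bar>) \<longlonglongrightarrow> \<bar>h e - g n e\<bar>" by (intro tendsto_intros lim)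
    show "\<forall>\<^sub>F m in sequentially. \<bar>g m e - g n e\<bar> \<le> \<epsilon> n"
      using near' by (auto simp: eventually_sequentially)
  qed simp
  have "orth_additive h"
    unfolding orth_additive_def
  proof (intro allI impI)
    fix e f :: 'e assume "e \<bottom> f"
    then have "(\<lambda>n. g n (e + f)) = (\<lambda>n. g n e + g n f)" using add by (simp add: orth_additive_def)
    then have "(\<lambda>n. g n (e + f)) \<longlonglongrightarrow> h e + h f" by (simp add: tendsto_add lim)
    then show "h (e + f) = h e + h f" using lim LIMSEQ_unique by blast
  qed
  moreover have "bounded (range h)"
  proof -
    have "g 0 = (\<lambda>_. 0)" using F0 by (simp add: g_def)
    then have "norm (h e) \<le> \<epsilon> 0" for e using h[of e 0] by simp
    then show ?thesis by (auto simp: bounded_iff)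
  qed
  ultimately obtain n where "h \<in> jordan_ball (real n)"
    using orth_additive_in_jordan_ball by blast
  \<comment> \<open>The limit lies in the ball with index \<open>Suc n\<close>, which was chosen to
    miss the Jordan ball of radius \<open>n\<close>.\<close>
  then show False using avoid h by blast
qed

text \<open>If the unit ball of the supremum norm lies in \<open>jordan_ball r\<close>, each of its
  elements in V is a difference of two states with coefficients at most \<open>r\<close>, so
  \<open>C = 2 * r\<close> works; the general case follows by scaling.\<close>

lemma norm_predual_le_sup:
  obtains C where "0 \<le> C"
    "\<And>(\<rho> :: 'e::jordan_ucp_space predual) c. (\<And>e. \<bar>fun_of \<rho> e\<bar> \<le> c) \<Longrightarrow> norm \<rho> \<le> C * c"
proof -
  obtain r where r: "\<And>h :: 'e \<Rightarrow> real. orth_additive h \<Longrightarrow> (\<And>e. \<bar>h e\<bar> \<le> 1) \<Longrightarrow> h \<in> jordan_ball r"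
    using sup_norm_ball_subset_jordan_ball by blast
  have unit: "norm \<rho> \<le> 2 * r" if \<rho>: "\<And>e. \<bar>fun_of \<rho> e\<bar> \<le> 1" for \<rho> :: "'e predual"
  proof -
    have "orth_additive (fun_of \<rho>)"
      by (rule fun_of_cases[of \<rho>]) (auto simp: orth_additive_def states_def algebra_simps)
    then have "fun_of \<rho> \<in> jordan_ball r" using r \<rho> by blast
    then obtain s t \<mu> \<nu> where *: "\<mu> \<in> states" "\<nu> \<in> states" "s \<in> {0..r}" "t \<in> {0..r}"
      "\<And>e. fun_of \<rho> e = s * \<mu> e - t * \<nu> e" by (rule jordan_ballE) blast
    have "\<rho> = s *\<^sub>R Abs_predual \<mu> - t *\<^sub>R Abs_predual \<nu>" using * by (intro predual_eqI) simp
    then have "norm \<rho> \<le> s * norm (Abs_predual \<mu>) + t * norm (Abs_predual \<nu>)"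
      using norm_triangle_ineq4[of "s *\<^sub>R Abs_predual \<mu>" "t *\<^sub>R Abs_predual \<nu>"] * by simp
    also have "\<dots> \<le> r * 1 + r * 1"
      using * by (intro add_mono mult_mono norm_Abs_state_le) auto
    finally show ?thesis by simp
  qed
  show thesis
  proof (rule that)
    show "0 \<le> 2 * r" using unit[of 0] by simp
    fix \<rho> :: "'e predual" and c assume c: "\<And>e. \<bar>fun_of \<rho> e\<bar> \<le> c"
    have "0 \<le> c" using c[of 0] by linarith
    show "norm \<rho> \<le> 2 * r * c"
    proof (cases "c = 0")
      case True
      then have "\<rho> = 0" using c by (intro predual_eqI) simp
      then show ?thesis using True by simp
    next
      case False
      then have "norm ((1 / c) *\<^sub>R \<rho>) \<le> 2 * r"
        using c \<open>0 \<le> c\<close> by (intro unit) (simp add: abs_mult divide_le_eq)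
      then show ?thesis using False \<open>0 \<le> c\<close> by (simp add: divide_le_eq)
    qed
  qed
qed

section \<open>Weak-* continuous linear maps\<close>

text \<open>Induction on \<open>I\<close>: subtracting a multiple of the new functional reduces to
  the common kernel of the remaining ones.\<close>

lemma linear_functional_in_span:
  fixes g :: "'i \<Rightarrow> 'v::real_vector \<Rightarrow> real"
  assumes "finite I" "\<And>i. i \<in> I \<Longrightarrow> linear (g i)" "linear \<phi>"
    and "\<And>w. (\<forall>i\<in>I. g i w = 0) \<Longrightarrow> \<phi> w = 0"
  shows "\<exists>c. \<forall>w. \<phi> w = (\<Sum>i\<in>I. c i * g i w)"
  using assms
proof (induction I arbitrary: \<phi> rule: finite_induct)
  case empty
  then show ?case by simp
next
  case (insert a I)
  have lin: "linear (g a)" "linear \<phi>" using insert.prems by auto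
  show ?case
  proof (cases "\<exists>w. (\<forall>i\<in>I. g i w = 0) \<and> g a w \<noteq> 0")
    \<comment> \<open>Common zeros of the family over \<open>I\<close> are then zeros of
      \<open>g a\<close> too, so the induction hypothesis applies to \<open>\<phi>\<close> itself
      and \<open>a\<close> gets coefficient 0.\<close>
    case False
    then obtain c where c: "\<And>w. \<phi> w = (\<Sum>i\<in>I. c i * g i w)"
      using insert.IH[of \<phi>] insert.prems by (metis insert_iff)
    have "\<phi> w = (\<Sum>i\<in>insert a I. (c(a := 0)) i * g i w)" for w
      using insert.hyps c[of w] by (auto intro!: sum.cong)
    then show ?thesis by blast
  next
    case True
    then obtain v where v: "\<And>i. i \<in> I \<Longrightarrow> g i v = 0" "g a v \<noteq> 0" by blast
    define k where "k = \<phi> v / g a v"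
    have lin': "linear (\<lambda>w. \<phi> w - k * g a w)"
      using lin by (simp add: linear_iff algebra_simps)
    have "\<phi> w - k * g a w = 0" if w: "\<forall>i\<in>I. g i w = 0" for w
    proof -
      \<comment> \<open>The projection of \<open>w\<close> along \<open>v\<close> into the kernel of
        \<open>g a\<close>; by the choice of \<open>k\<close>, \<open>\<phi> u\<close> equals
        \<open>\<phi> w - k * g a w\<close>.\<close>
      define u where "u = w - (g a w / g a v) *\<^sub>R v"
      have "g i u = 0" if "i \<in> insert a I" for i
        using that v w insert.prems(1)[OF that]
        by (auto simp: u_def linear_diff linear_cmul)
      then have "\<phi> u = 0" using insert.prems(3) by blast
      then show ?thesis using lin(2) by (simp add: u_def k_def linear_diff linear_cmul)
    qed
    then obtain c where c: "\<And>w. \<phi> w - k * g a w = (\<Sum>i\<in>I. c i * g i w)"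
      using insert.IH[OF _ lin'] insert.prems(1) by (metis insert_iff)
    have "\<phi> w = (\<Sum>i\<in>insert a I. (c(a := k)) i * g i w)" for w
    proof -
      have "(\<Sum>i\<in>I. (c(a := k)) i * g i w) = (\<Sum>i\<in>I. c i * g i w)"
        using insert.hyps by (intro sum.cong) auto
      then show ?thesis using insert.hyps c[of w] by simp
    qed
    then show ?thesis by blast
  qed
qed

section \<open>Evaluations and adjoints in the weak-* topology\<close>

lemma topspace_weak_star: "topspace weak_star = UNIV"
  by (simp add: weak_star_def topspace_pullback_topology)

lemma continuous_map_weak_star_eval:
  "continuous_map weak_star euclideanreal (\<lambda>y. blinfun_apply y v)"
proof -
  have "continuous_map weak_star euclideanreal ((\<lambda>f. f v) \<circ> blinfun_apply)"
    unfolding weak_star_def by (intro continuous_map_pullback continuous_map_product_coordinates) simp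
  then show ?thesis by (simp add: comp_def)
qed

text \<open>Continuity at 0 bounds \<open>\<phi>\<close> on a basic neighbourhood. This contains the
  subspace annihilating finitely many vectors, on which \<open>\<phi>\<close> must vanish, so
  \<open>\<phi>\<close> is a combination of evaluations at those vectors.\<close>

lemma weak_star_functional_is_eval:
  fixes \<phi> :: "('v::real_normed_vector \<Rightarrow>\<^sub>L real) \<Rightarrow> real"
  assumes lin: "linear \<phi>" and cont: "continuous_map weak_star euclideanreal \<phi>"
  obtains v where "\<And>y. \<phi> y = blinfun_apply y v"
proof -
  have "openin weak_star {y \<in> topspace weak_star. \<phi> y \<in> {-1<..<1}}"
    using cont by (rule openin_continuous_map_preimage) simp
  then have "openin (pullback_topology UNIV blinfun_apply
      (product_topology (\<lambda>_. euclideanreal) UNIV)) {y. \<phi> y \<in> {-1<..<1}}"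
    unfolding topspace_weak_star by (simp add: weak_star_def)
  then obtain W where W: "openin (product_topology (\<lambda>_. euclideanreal) UNIV) W"
    "{y. \<phi> y \<in> {-1<..<1}} = blinfun_apply -` W"
    by (auto simp: openin_pullback_topology)
  have "\<phi> 0 = 0" using lin by (rule linear_0)
  then have "blinfun_apply 0 \<in> W" using W(2) by auto
  then obtain U where U: "finite {v. U v \<noteq> UNIV}" "blinfun_apply 0 \<in> PiE UNIV U" "PiE UNIV U \<subseteq> W"
    using W(1) unfolding openin_product_topology_alt by fastforce
  \<comment> \<open>The finitely many coordinates that the basic open set really restricts.\<close>
  define I where "I = {v. U v \<noteq> (UNIV :: real set)}"
  have small: "\<bar>\<phi> y\<bar> < 1" if "\<forall>v\<in>I. blinfun_apply y v = 0" for y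
  proof -
    have "blinfun_apply y v \<in> U v" for v
      using that U(2) by (cases "v \<in> I") (auto simp: I_def PiE_UNIV_domain)
    then have "blinfun_apply y \<in> W" using U(3) by (auto simp: PiE_UNIV_domain)
    then have "y \<in> {y. \<phi> y \<in> {-1<..<1}}" unfolding W(2) by simp
    then show ?thesis by auto
  qed
  have "\<phi> y = 0" if "\<forall>v\<in>I. blinfun_apply y v = 0" for y
  proof (rule ccontr)
    assume "\<phi> y \<noteq> 0"
    \<comment> \<open>On this scaled element \<open>\<phi>\<close> takes the value 1.\<close>
    moreover have "\<bar>\<phi> ((1 / \<phi> y) *\<^sub>R y)\<bar> < 1"
      using that by (intro small) (simp add: blinfun.scaleR_left)
    ultimately show False using lin by (simp add: linear_cmul)
  qed
  then obtain c where c: "\<And>y. \<phi> y = (\<Sum>v\<in>I. c v * blinfun_apply y v)"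
    using linear_functional_in_span[of I "\<lambda>v y. blinfun_apply y v" \<phi>] lin U(1)
    by (auto simp: I_def linear_iff blinfun.add_left blinfun.scaleR_left)
  have "\<phi> y = blinfun_apply y (\<Sum>v\<in>I. c v *\<^sub>R v)" for y
    by (simp add: c blinfun.sum_right blinfun.scaleR_right)
  then show thesis by (rule that)
qed

text \<open>Evaluating \<open>y o\<^sub>L S\<close> at a vector is evaluating \<open>y\<close> at
  its image under \<open>S\<close>.\<close>

lemma continuous_map_weak_star_adjoint:
  "continuous_map weak_star weak_star (\<lambda>y. y o\<^sub>L S)"
proof -
  have "continuous_map weak_star (product_topology (\<lambda>_. euclideanreal) UNIV)
      (blinfun_apply \<circ> (\<lambda>y. y o\<^sub>L S))"
    by (simp add: continuous_map_componentwise_UNIV continuous_map_weak_star_eval)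
  then show ?thesis
    unfolding weak_star_def by (intro continuous_map_pullback') auto
qed

lemma blinfun_apply_event [simp]: "blinfun_apply (event e) \<rho> = fun_of \<rho> e"
  by (simp add: event.rep_eq)

text \<open>Each map followed by evaluation at \<open>v\<close> is evaluation at some element of V.
  Agreement on events makes the two elements equal as functions on E, hence equal in V.\<close>

lemma weak_star_linear_map_eqI:
  fixes F G :: "'e::jordan_ucp_space dual \<Rightarrow> ('v::real_normed_vector \<Rightarrow>\<^sub>L real)"
  assumes "linear F" "continuous_map weak_star weak_star F"
    and "linear G" "continuous_map weak_star weak_star G"
    and ev: "\<And>e. F (event e) = G (event e)"
  shows "F = G"
proof (intro ext blinfun_eqI)
  fix y and v :: 'v
  have eval: "\<exists>\<sigma>. \<forall>y. blinfun_apply (H y) v = blinfun_apply y \<sigma>"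
    if H: "linear H" "continuous_map weak_star weak_star H" for H :: "'e dual \<Rightarrow> ('v \<Rightarrow>\<^sub>L real)"
  proof -
    have "linear (\<lambda>y. blinfun_apply (H y) v)"
      using H(1) by (simp add: linear_iff blinfun.add_left blinfun.scaleR_left)
    moreover have "continuous_map weak_star euclideanreal (\<lambda>y. blinfun_apply (H y) v)"
      using continuous_map_compose[OF H(2) continuous_map_weak_star_eval] by (simp add: comp_def)
    ultimately show ?thesis by (rule weak_star_functional_is_eval) blast
  qed
  obtain \<sigma> where \<sigma>: "\<And>y. blinfun_apply (F y) v = blinfun_apply y \<sigma>" using eval assms(1,2) by blast
  obtain \<tau> where \<tau>: "\<And>y. blinfun_apply (G y) v = blinfun_apply y \<tau>" using eval assms(3,4) by blast
  have "\<sigma> = \<tau>"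
    using \<sigma>[of "event _"] \<tau>[of "event _"] ev by (intro predual_eqI) simp
  then show "blinfun_apply (F y) v = blinfun_apply (G y) v" by (simp add: \<sigma> \<tau>)
qed

section \<open>The pre-adjoint of the extension\<close>

lemma T_op_predual:
  fixes x :: "'e::jordan_ucp_space dual"
  assumes I3: "\<And>e1 e2 e3 :: 'e. \<lbrakk>e1 \<bottom> e2; e2 \<bottom> e3; e1 \<bottom> e3\<rbrakk> \<Longrightarrow> I3 e1 e2 e3 = (\<lambda>_. 0)"
  obtains S :: "'e predual \<Rightarrow>\<^sub>L 'e predual"
    where "\<And>\<rho> e. fun_of (blinfun_apply S \<rho>) e = blinfun_apply (T_op e x) \<rho>"
proof -
  have bound: "\<bar>blinfun_apply (T_op e x) \<rho>\<bar> \<le> 2 * norm x * norm \<rho>" for e \<rho>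
    using order_trans[OF norm_blinfun mult_right_mono[OF norm_T_op_le norm_ge_zero]]
    by (metis real_norm_def)
  have "\<exists>\<sigma>. \<forall>e. fun_of \<sigma> e = blinfun_apply (T_op e x) \<rho>" for \<rho>
  proof -
    have "bounded (range (\<lambda>e. blinfun_apply (T_op e x) \<rho>))"
      unfolding bounded_iff using bound by auto
    \<comment> \<open>This decomposition is exactly the membership condition of the type
      \<open>predual\<close>.\<close>
    then have "\<exists>s t \<mu> \<nu>. \<mu> \<in> states \<and> \<nu> \<in> states \<and> 0 \<le> s \<and> 0 \<le> t \<and>
        (\<lambda>e. blinfun_apply (T_op e x) \<rho>) = (\<lambda>e. s * \<mu> e - t * \<nu> e)"
      using T_op_additive[OF I3] by (intro Jordan_decomposition) (simp_all add: blinfun.add_left)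
    then show ?thesis
      by (intro exI[of _ "Abs_predual (\<lambda>e. blinfun_apply (T_op e x) \<rho>)"]) (simp add: Abs_predual_inverse)
  qed
  then obtain S where S: "\<And>\<rho> e. fun_of (S \<rho>) e = blinfun_apply (T_op e x) \<rho>" by metis
  obtain C where C: "0 \<le> C" "\<And>(\<rho> :: 'e predual) c. (\<And>e. \<bar>fun_of \<rho> e\<bar> \<le> c) \<Longrightarrow> norm \<rho> \<le> C * c"
    using norm_predual_le_sup by blast
  have "bounded_linear S"
  proof (rule bounded_linear_intro)
    show "S (\<rho> + \<sigma>) = S \<rho> + S \<sigma>" for \<rho> \<sigma>
      by (rule predual_eqI) (simp add: S blinfun.add_right)
    show "S (a *\<^sub>R \<rho>) = a *\<^sub>R S \<rho>" for a \<rho>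
      by (rule predual_eqI) (simp add: S blinfun.scaleR_right)
    \<comment> \<open>The supremum of \<open>S \<rho>\<close> over events is controlled by the
      uniform bound on \<open>T_op\<close>; the constant \<open>C\<close> converts it into the base
      norm.\<close>
    show "norm (S \<rho>) \<le> norm \<rho> * (C * (2 * norm x))" for \<rho>
      using C(2)[of "S \<rho>" "2 * norm x * norm \<rho>"] bound by (simp add: S mult_ac)
  qed
  then have "fun_of (blinfun_apply (Blinfun S) \<rho>) e = blinfun_apply (T_op e x) \<rho>" for \<rho> e
    by (simp add: bounded_linear_Blinfun_apply S)
  then show thesis by (rule that)
qed

theorem lemma9p1:
  fixes x :: "'e::jordan_ucp_space dual"
  assumes "\<And>e1 e2 e3 :: 'e. \<lbrakk>e1 \<bottom> e2; e2 \<bottom> e3; e1 \<bottom> e3\<rbrakk> \<Longrightarrow> I3 e1 e2 e3 = (\<lambda>_. 0)"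
  shows "\<exists>!Tx :: 'e dual \<Rightarrow> 'e dual.
    linear Tx \<and> continuous_map weak_star weak_star Tx \<and> (\<forall>e. Tx (event e) = T_op e x)"
proof -
  obtain S :: "'e predual \<Rightarrow>\<^sub>L 'e predual"
    where S: "\<And>\<rho> e. fun_of (blinfun_apply S \<rho>) e = blinfun_apply (T_op e x) \<rho>"
    using T_op_predual[OF assms] by blast
  show ?thesis
  \<comment> \<open>The witness is the adjoint of \<open>S\<close>; on an event it evaluates
    \<open>S \<rho>\<close> there, which is the value of \<open>T_op e x\<close> at
    \<open>\<rho>\<close>.\<close>
  proof (rule ex1I[of _ "\<lambda>y. y o\<^sub>L S"], intro conjI allI)
    show "linear (\<lambda>y::'e dual. y o\<^sub>L S)"
      by (auto simp: linear_iff intro!: blinfun_eqI simp: blinfun.add_left blinfun.scaleR_left)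
    show "continuous_map weak_star weak_star (\<lambda>y::'e dual. y o\<^sub>L S)"
      by (rule continuous_map_weak_star_adjoint)
    show ev: "event e o\<^sub>L S = T_op e x" for e
      by (rule blinfun_eqI) (simp add: S)
    fix F :: "'e dual \<Rightarrow> 'e dual"
    assume "linear F \<and> continuous_map weak_star weak_star F \<and> (\<forall>e. F (event e) = T_op e x)"
    then show "F = (\<lambda>y. y o\<^sub>L S)"
      using \<open>linear (\<lambda>y::'e dual. y o\<^sub>L S)\<close> continuous_map_weak_star_adjoint
      by (intro weak_star_linear_map_eqI) (simp_all add: ev)
  qed
qed

end
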